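(* (a) Let $\mathcal H$ be the horizontal sub-bundle on $\mathrm{Diff}\,S^1$ (respectively on $\widetilde{\mathrm{Diff}}\,S^1$) obtained by left translations of $\mathrm{Vect}_0S^1$. Then any pair of points of $\mathrm{Diff}\,S^1$ (respectively $\widetilde{\mathrm{Diff}}\,S^1$) can be connected by an $\mathcal H$-horizontal curve. (b) Let $\mathcal E$ be the horizontal sub-bundle on $\mathcal G_{\mu\nu}$ obtained by left translations of $\mathrm{Vect}_0S^1$, identified with $(\mathrm{Vect}_0S^1,0)\subset\mathfrak g_{\mu\nu}$. Then any two points of $\mathcal G_{\mu\nu}$ can be connected by an $\mathcal E$-horizontal curve.
   Context: $\mathrm{Diff}\,S^1$ is the Fréchet Lie group of smooth orientation preserving diffeomorphisms of $S^1=\mathbb R/2\pi\mathbb Z$ under composition; $\widetilde{\mathrm{Diff}}\,S^1$ is its universal cover, the group of smooth orientation preserving diffeomorphisms $\phi$ of $\mathbb R$ with $\phi(\theta+2\pi)=\phi(\theta)+2\pi$. Their Lie algebra is $\mathrm{Vect}\,S^1=\{x\,\partial_\theta: x\in C^\infty(S^1)\}$ with bracket $[x\partial_\theta,y\partial_\theta]=(x'y-y'x)\partial_\theta$, where $'=\partial_\theta$. $\mathrm{Vect}_0S^1$ is the subspace of fields $x\,\partial_\theta$ with zero mean value, $\frac1{2\pi}\int_0^{2\pi}x\,d\theta=0$. For real parameters $\mu,\nu$, $\mathcal G_{\mu\nu}$ is the simply connected Lie group with underlying set $\widetilde{\mathrm{Diff}}\,S^1\times\mathbb R$ and multiplication $$(\phi_1,b_1)(\phi_2,b_2)=\big(\phi_1\circ\phi_2,\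 b_1+b_2+\mu A(\phi_1,\phi_2)+\nu B(\phi_1,\phi_2)\big),$$ $$A(\phi_1,\phi_2)=\frac1{4\pi}\int_0^{2\pi}(-\phi_1\circ\phi_2+\phi_1+\phi_2-\mathrm{id})\,d\theta,\qquad B(\phi_1,\phi_2)=\frac1{4\pi}\int_0^{2\pi}\log(\phi_1\circ\phi_2)'\,d\log\phi_2'.$$ Its Lie algebra is $\mathfrak g_{\mu\nu}=\mathrm{Vect}\,S^1\oplus\mathbb R$ with $[(x,a_1),(y,a_2)]=([x,y],\omega_{\mu\nu}(x,y))$, $\omega_{\mu\nu}(x,y)=\frac1{2\pi}\int_0^{2\pi}(\mu xy'+\nu x'y'')\,d\theta$. The groups $\mathcal G_{\mu\nu}$ with $\nu\ne0$ are all isomorphic and are called the Virasoro–Bott group; $\mathcal G_{\mu0}$ is isomorphic to the direct product $\widetilde{\mathrm{Diff}}\,S^1\times\mathbb R$. A horizontal curve in one of these groups is a smooth curve $\gamma$ on $[0,1]$ with $\dot\gamma(t)$ in the given sub-bundle for every $t$; equivalently its left logarithmic derivative $d\ell_{\gamma(t)^{-1}}\dot\gamma(t)$ ($\ell_a$ is left multiplication by $a$) lies in $\mathrm{Vect}_0S^1$ (respectively $(\mathrm{Vect}_0S^1,0)$) for all $t$. On $\mathrm{Diff}\,S^1$ and $\widetilde{\mathrm{Diff}}\,S^1$ the left logarithmic derivative is $\dot\gamma/\gamma'$.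
   Formalization: Part (b) is proved for ν ≠ 0 (any real μ); for ν = 0 it is false, since b + (μ/4π)∫(φ − id)dθ is a homomorphism constant along horizontal curves, so (id,0) and (id,1) cannot be connected. *)

theory Defs
  imports "HOL-Analysis.Analysis" "HOL-Algebra.Group"
begin

definition D :: "(real \<Rightarrow> 'a::real_normed_vector) \<Rightarrow> real \<Rightarrow> 'a" where
  "D f = (\<lambda>x. vector_derivative f (at x))"

definition smooth :: "(real \<Rightarrow> 'a::real_normed_vector) \<Rightarrow> bool" where
  "smooth f \<longleftrightarrow> (\<forall>k x. (D ^^ k) f differentiable (at x))"

text \<open>Derivative at \<open>t\<close> (one-sided at the endpoints of the parameter interval \<open>[0,1]\<close>) of a
  curve \<open>c\<close> of smooth functions in the Frechet topology of \<open>C\<^sup>\<infinity>\<close>: all derivatives of the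
  difference quotients converge uniformly. In all uses below \<open>c s - c t\<close> is \<open>2\<pi>\<close>-periodic, so that
  uniformity on the line is uniformity on the compact circle.\<close>

definition has_Cinf_derivative ::
    "(real \<Rightarrow> real \<Rightarrow> 'a::real_normed_vector) \<Rightarrow> (real \<Rightarrow> 'a) \<Rightarrow> real \<Rightarrow> bool" where
  "has_Cinf_derivative c v t \<longleftrightarrow>
     (\<forall>k. uniform_limit UNIV
            (\<lambda>s \<theta>. ((D ^^ k) (c s) \<theta> - (D ^^ k) (c t) \<theta>) /\<^sub>R (s - t))
            ((D ^^ k) v) (at t within {0..1}))"

text \<open>The witness \<open>C n\<close> is the \<open>n\<close>-th derivative of the curve.\<close>

definition smooth_Cinf_curve :: "(real \<Rightarrow> real \<Rightarrow> 'a::real_normed_vector) \<Rightarrow> bool" where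
  "smooth_Cinf_curve c \<longleftrightarrow>
     (\<exists>C :: nat \<Rightarrow> real \<Rightarrow> real \<Rightarrow> 'a.
        C 0 = c \<and>
        (\<forall>n. \<forall>t\<in>{0..1}. smooth (C n t) \<and> has_Cinf_derivative (C n) (C (Suc n) t) t))"

definition smooth_real_curve :: "(real \<Rightarrow> real) \<Rightarrow> bool" where
  "smooth_real_curve b \<longleftrightarrow>
     (\<exists>\<beta> :: nat \<Rightarrow> real \<Rightarrow> real.
        \<beta> 0 = b \<and>
        (\<forall>n. \<forall>t\<in>{0..1}. (\<beta> n has_real_derivative \<beta> (Suc n) t) (at t within {0..1})))"

text \<open>A field \<open>x \<partial>\<^sub>\<theta>\<close> is represented by its \<open>2\<pi>\<close>-periodic coefficient \<open>x\<close>.\<close>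

definition Vect :: "(real \<Rightarrow> real) set" where
  "Vect = {x. smooth x \<and> (\<forall>\<theta>. x (\<theta> + 2 * pi) = x \<theta>)}"

definition Vect0 :: "(real \<Rightarrow> real) set" where
  "Vect0 = {x \<in> Vect. 1 / (2 * pi) * integral {0..2 * pi} x = 0}"

quotient_type circle = real / "\<lambda>a b. \<exists>k::int. a = b + 2 * pi * of_int k"
proof (rule equivpI)
  show "reflp (\<lambda>a b. \<exists>k::int. a = b + 2 * pi * of_int k)"
    by (rule reflpI) (rule exI[of _ 0], simp)
  show "symp (\<lambda>a b. \<exists>k::int. a = b + 2 * pi * of_int k)"
  proof (rule sympI)
    fix a b :: real
    assume "\<exists>k::int. a = b + 2 * pi * of_int k"
    then obtain k :: int where "a = b + 2 * pi * of_int k" by blast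
    then show "\<exists>k::int. b = a + 2 * pi * of_int k" by (intro exI[of _ "- k"]) simp
  qed
  show "transp (\<lambda>a b. \<exists>k::int. a = b + 2 * pi * of_int k)"
  proof (rule transpI)
    fix a b c :: real
    assume "\<exists>k::int. a = b + 2 * pi * of_int k" "\<exists>k::int. b = c + 2 * pi * of_int k"
    then obtain k l :: int where "a = b + 2 * pi * of_int k" "b = c + 2 * pi * of_int l" by blast
    then show "\<exists>k::int. a = c + 2 * pi * of_int k"
      by (intro exI[of _ "k + l"]) (simp add: algebra_simps)
  qed
qed

lift_definition circle_emb :: "circle \<Rightarrow> complex" is cis
  by (auto simp: complex_eq_iff cos_add sin_add)

text \<open>The differential structure of the circle, as a source of maps, is given by the angle
  coordinate \<open>abs_circle\<close>, and, as a target, by the embedding \<open>circle_emb\<close> onto the unit circle.\<close>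

definition circle_map :: "(circle \<Rightarrow> circle) \<Rightarrow> real \<Rightarrow> complex" where
  "circle_map f = (\<lambda>\<theta>. circle_emb (f (abs_circle \<theta>)))"

text \<open>The vector \<open>\<i> * z\<close> is the positively oriented unit tangent vector at a point \<open>z\<close> of the unit
  circle; this gives the orientation condition.\<close>

definition DiffS1 :: "(circle \<Rightarrow> circle) monoid" where
  "DiffS1 = \<lparr>
     carrier = {f. bij f \<and> smooth (circle_map f) \<and> smooth (circle_map (inv_into UNIV f)) \<and>
                   (\<forall>\<theta>. \<exists>r>0. D (circle_map f) \<theta> = r *\<^sub>R (\<i> * circle_map f \<theta>))},
     monoid.mult = (\<circ>), one = id \<rparr>"

definition DiffR :: "(real \<Rightarrow> real) monoid" where
  "DiffR = \<lparr>
     carrier = {\<phi>. bij \<phi> \<and> smooth \<phi> \<and> smooth (inv_into UNIV \<phi>) \<and>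
                   (\<forall>\<theta>. 0 < deriv \<phi> \<theta>) \<and> (\<forall>\<theta>. \<phi> (\<theta> + 2 * pi) = \<phi> \<theta> + 2 * pi)},
     monoid.mult = (\<circ>), one = id \<rparr>"

definition cocycleA :: "(real \<Rightarrow> real) \<Rightarrow> (real \<Rightarrow> real) \<Rightarrow> real" where
  "cocycleA \<phi>1 \<phi>2 = 1 / (4 * pi) *
     integral {0..2 * pi} (\<lambda>\<theta>. - \<phi>1 (\<phi>2 \<theta>) + \<phi>1 \<theta> + \<phi>2 \<theta> - \<theta>)"

definition cocycleB :: "(real \<Rightarrow> real) \<Rightarrow> (real \<Rightarrow> real) \<Rightarrow> real" where
  "cocycleB \<phi>1 \<phi>2 = 1 / (4 * pi) *
     integral {0..2 * pi} (\<lambda>\<theta>. ln (deriv (\<phi>1 \<circ> \<phi>2) \<theta>) * deriv (\<lambda>\<tau>. ln (deriv \<phi>2 \<tau>)) \<theta>)"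

definition VirG :: "real \<Rightarrow> real \<Rightarrow> ((real \<Rightarrow> real) \<times> real) monoid" where
  "VirG \<mu> \<nu> = \<lparr>
     carrier = carrier DiffR \<times> UNIV,
     monoid.mult = (\<lambda>(\<phi>1, b1) (\<phi>2, b2).
       (\<phi>1 \<circ> \<phi>2, b1 + b2 + \<mu> * cocycleA \<phi>1 \<phi>2 + \<nu> * cocycleB \<phi>1 \<phi>2)),
     one = (id, 0) \<rparr>"

text \<open>The left logarithmic derivative of \<open>\<gamma>\<close> at \<open>t\<close> is the derivative at \<open>s = t\<close> of the curve
  \<open>s \<mapsto> \<gamma>(t)\<^sup>-\<^sup>1 \<gamma>(s)\<close>, which passes through the unit. In \<open>DiffS1\<close> the tangent vector
  \<open>x \<partial>\<^sub>\<theta>\<close> at the unit is, under the embedding, the function \<open>\<theta> \<mapsto> x(\<theta>) \<i> cis \<theta>\<close>.\<close>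

definition has_left_log_deriv_S1 ::
    "(real \<Rightarrow> circle \<Rightarrow> circle) \<Rightarrow> (real \<Rightarrow> real) \<Rightarrow> real \<Rightarrow> bool" where
  "has_left_log_deriv_S1 \<gamma> x t \<longleftrightarrow>
     has_Cinf_derivative
       (\<lambda>s. circle_map (inv\<^bsub>DiffS1\<^esub> (\<gamma> t) \<otimes>\<^bsub>DiffS1\<^esub> \<gamma> s)) (\<lambda>\<theta>. x \<theta> *\<^sub>R (\<i> * cis \<theta>)) t"

definition has_left_log_deriv_R ::
    "(real \<Rightarrow> real \<Rightarrow> real) \<Rightarrow> (real \<Rightarrow> real) \<Rightarrow> real \<Rightarrow> bool" where
  "has_left_log_deriv_R \<gamma> x t \<longleftrightarrow>
     has_Cinf_derivative (\<lambda>s. inv\<^bsub>DiffR\<^esub> (\<gamma> t) \<otimes>\<^bsub>DiffR\<^esub> \<gamma> s) x t"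

definition has_left_log_deriv_VirG ::
    "real \<Rightarrow> real \<Rightarrow> (real \<Rightarrow> (real \<Rightarrow> real) \<times> real) \<Rightarrow> (real \<Rightarrow> real) \<times> real \<Rightarrow> real \<Rightarrow> bool" where
  "has_left_log_deriv_VirG \<mu> \<nu> \<gamma> v t \<longleftrightarrow>
     has_Cinf_derivative (\<lambda>s. fst (inv\<^bsub>VirG \<mu> \<nu>\<^esub> (\<gamma> t) \<otimes>\<^bsub>VirG \<mu> \<nu>\<^esub> \<gamma> s)) (fst v) t \<and>
     ((\<lambda>s. snd (inv\<^bsub>VirG \<mu> \<nu>\<^esub> (\<gamma> t) \<otimes>\<^bsub>VirG \<mu> \<nu>\<^esub> \<gamma> s)) has_real_derivative snd v) (at t within {0..1})"

definition horizontal_S1 :: "(real \<Rightarrow> circle \<Rightarrow> circle) \<Rightarrow> bool" where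
  "horizontal_S1 \<gamma> \<longleftrightarrow>
     (\<forall>t\<in>{0..1}. \<gamma> t \<in> carrier DiffS1) \<and> smooth_Cinf_curve (\<lambda>t. circle_map (\<gamma> t)) \<and>
     (\<forall>t\<in>{0..1}. \<exists>x\<in>Vect0. has_left_log_deriv_S1 \<gamma> x t)"

definition horizontal_R :: "(real \<Rightarrow> real \<Rightarrow> real) \<Rightarrow> bool" where
  "horizontal_R \<gamma> \<longleftrightarrow>
     (\<forall>t\<in>{0..1}. \<gamma> t \<in> carrier DiffR) \<and> smooth_Cinf_curve \<gamma> \<and>
     (\<forall>t\<in>{0..1}. \<exists>x\<in>Vect0. has_left_log_deriv_R \<gamma> x t)"

definition horizontal_VirG ::
    "real \<Rightarrow> real \<Rightarrow> (real \<Rightarrow> (real \<Rightarrow> real) \<times> real) \<Rightarrow> bool" where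
  "horizontal_VirG \<mu> \<nu> \<gamma> \<longleftrightarrow>
     (\<forall>t\<in>{0..1}. \<gamma> t \<in> carrier (VirG \<mu> \<nu>)) \<and>
     smooth_Cinf_curve (\<lambda>t. fst (\<gamma> t)) \<and> smooth_real_curve (\<lambda>t. snd (\<gamma> t)) \<and>
     (\<forall>t\<in>{0..1}. \<exists>v\<in>Vect0 \<times> {0}. has_left_log_deriv_VirG \<mu> \<nu> \<gamma> v t)"

end

theory Submission
  imports Defs
begin

text \<open>Left translation turns the velocity of a curve \<open>\<phi>\<close> of diffeomorphisms into the field
  \<open>x = \<partial>\<^sub>t\<phi> / \<phi>'\<close>, so that \<open>\<phi>\<close> is horizontal iff \<open>\<integral> x = 0\<close>. For
  \<open>\<phi>(t,\<theta>) = \<theta> + c(t) + v(t,\<theta>)\<close> this condition determines \<open>c'\<close> and leaves \<open>v\<close> arbitrary. In the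
  Virasoro-Bott group the fibre coordinate \<open>b\<close> is determined as well: up to constant factors \<open>b'\<close> is
  the sum of \<open>\<mu> \<integral> \<partial>\<^sub>t\<phi>\<close>, whose total depends on the end points only, and of the flux
  \<open>\<nu> \<integral> x' \<phi>'' / \<phi>'\<close>. It remains to join given end points with a prescribed total of \<open>c'\<close> and a
  prescribed total flux.

  Take \<open>v(t,\<theta>) = \<Sum>\<^sub>i \<rho>\<^sub>i(t) h\<^sub>i(\<theta> - w\<^sub>i t)\<close> with four bumps \<open>\<rho>\<^sub>i\<close> of disjoint supports. The first and
  the last profile carry the end points, and the other two are sine waves of frequencies 1 and 2 that
  rotate at the speeds \<open>w\<^sub>1\<close> and \<open>w\<^sub>2\<close>. Both totals are affine in the speeds. By the scaling of the
  frequency their linear parts are \<open>K (w\<^sub>1 + w\<^sub>2)\<close> and \<open>L (w\<^sub>1 + 4 w\<^sub>2)\<close>, where \<open>K\<close> and \<open>L\<close> are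
  nonzero, so that both totals can be prescribed. The case of the circle follows by lifting to the line.\<close>

section \<open>Jointly smooth functions of two real variables\<close>

text \<open>Joint continuity is demanded at every level, because partial derivatives along the axes
  do not imply it. The partial derivatives are existential witnesses, so closure rules go by
  induction on \<open>n\<close> with explicit product and chain rule formulas.\<close>

primrec Ck :: "nat \<Rightarrow> (real \<Rightarrow> real \<Rightarrow> 'a::banach) \<Rightarrow> bool" where
  "Ck 0 F \<longleftrightarrow> continuous_on UNIV (\<lambda>p. F (fst p) (snd p))"
| "Ck (Suc n) F \<longleftrightarrow> continuous_on UNIV (\<lambda>p. F (fst p) (snd p)) \<and>
     (\<exists>Ft Fx. (\<forall>t x. ((\<lambda>s. F s x) has_vector_derivative Ft t x) (at t)) \<and>
              (\<forall>t x. (F t has_vector_derivative Fx t x) (at x)) \<and> Ck n Ft \<and> Ck n Fx)"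

definition smooth2 :: "(real \<Rightarrow> real \<Rightarrow> 'a::banach) \<Rightarrow> bool" where
  "smooth2 F \<longleftrightarrow> (\<forall>n. Ck n F)"

definition Dt :: "(real \<Rightarrow> real \<Rightarrow> 'a::real_normed_vector) \<Rightarrow> real \<Rightarrow> real \<Rightarrow> 'a" where
  "Dt F = (\<lambda>t x. vector_derivative (\<lambda>s. F s x) (at t))"

text \<open>Going through \<open>D\<close> makes the iterates of \<open>Dx\<close> restrict to
  iterates of \<open>D\<close> on each slice \<open>F t\<close>, the form in which
  \<open>has_Cinf_derivative\<close> is stated.\<close>

definition Dx :: "(real \<Rightarrow> real \<Rightarrow> 'a::real_normed_vector) \<Rightarrow> real \<Rightarrow> real \<Rightarrow> 'a" where
  "Dx F = (\<lambda>t. D (F t))"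

lemma Ck_continuous: "Ck n F \<Longrightarrow> continuous_on UNIV (\<lambda>p. F (fst p) (snd p))"
  by (cases n) auto

lemma Ck_SucI:
  assumes "continuous_on UNIV (\<lambda>p. F (fst p) (snd p))"
    "\<And>t x. ((\<lambda>s. F s x) has_vector_derivative Ft t x) (at t)"
    "\<And>t x. (F t has_vector_derivative Fx t x) (at x)" "Ck n Ft" "Ck n Fx"
  shows "Ck (Suc n) F"
  using assms by auto

lemma Ck_Suc_imp: "Ck (Suc n) F \<Longrightarrow> Ck n F"
proof (induction n arbitrary: F)
  case 0
  then show ?case using Ck_continuous by auto
next
  case (Suc n)
  then obtain Ft Fx where F: "continuous_on UNIV (\<lambda>p. F (fst p) (snd p))"
    "\<And>t x. ((\<lambda>s. F s x) has_vector_derivative Ft t x) (at t)"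
    "\<And>t x. (F t has_vector_derivative Fx t x) (at x)" "Ck (Suc n) Ft" "Ck (Suc n) Fx"
    unfolding Ck.simps(2)[of "Suc n"] by blast
  then show ?case by (intro Ck_SucI[OF F(1-3)] Suc.IH)
qed

lemma Ck_const: "Ck n (\<lambda>t x. c)"
proof (induction n arbitrary: c)
  case (Suc n)
  show ?case by (rule Ck_SucI[of _ "\<lambda>_ _. 0" "\<lambda>_ _. 0"]) (auto intro: Suc)
qed auto

lemma Ck_fst: "Ck n (\<lambda>t x. t)"
proof (cases n)
  case (Suc m)
  show ?thesis unfolding Suc
    by (rule Ck_SucI[of _ "\<lambda>_ _. 1" "\<lambda>_ _. 0"]) (auto intro!: Ck_const continuous_intros)
qed (auto intro!: continuous_intros)

lemma Ck_snd: "Ck n (\<lambda>t x. x)"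
proof (cases n)
  case (Suc m)
  show ?thesis unfolding Suc
    by (rule Ck_SucI[of _ "\<lambda>_ _. 0" "\<lambda>_ _. 1"]) (auto intro!: Ck_const continuous_intros)
qed (auto intro!: continuous_intros)

lemma Ck_add: "Ck n F \<Longrightarrow> Ck n G \<Longrightarrow> Ck n (\<lambda>t x. F t x + G t x)"
proof (induction n arbitrary: F G)
  case 0
  then show ?case by (auto intro!: continuous_intros)
next
  case (Suc n)
  obtain Ft Fx where F: "\<And>t x. ((\<lambda>s. F s x) has_vector_derivative Ft t x) (at t)"
    "\<And>t x. (F t has_vector_derivative Fx t x) (at x)" "Ck n Ft" "Ck n Fx"
    using Suc.prems(1) unfolding Ck.simps by blast
  obtain Gt Gx where G: "\<And>t x. ((\<lambda>s. G s x) has_vector_derivative Gt t x) (at t)"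
    "\<And>t x. (G t has_vector_derivative Gx t x) (at x)" "Ck n Gt" "Ck n Gx"
    using Suc.prems(2) unfolding Ck.simps by blast
  show ?case
    by (rule Ck_SucI[of _ "\<lambda>t x. Ft t x + Gt t x" "\<lambda>t x. Fx t x + Gx t x"])
      (use F G Suc in \<open>auto intro!: continuous_intros derivative_intros simp del: Ck.simps dest: Ck_continuous\<close>)
qed

lemma Ck_scaleR:
  assumes "Ck n F" "Ck n G" shows "Ck n (\<lambda>t x. F t x *\<^sub>R G t x)"
  using assms
proof (induction n arbitrary: F G)
  case 0
  then show ?case by (auto intro!: continuous_intros)
next
  case (Suc n)
  obtain Ft Fx where F: "\<And>t x. ((\<lambda>s. F s x) has_vector_derivative Ft t x) (at t)"
    "\<And>t x. (F t has_vector_derivative Fx t x) (at x)" "Ck n Ft" "Ck n Fx"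
    using Suc.prems(1) unfolding Ck.simps by blast
  obtain Gt Gx where G: "\<And>t x. ((\<lambda>s. G s x) has_vector_derivative Gt t x) (at t)"
    "\<And>t x. (G t has_vector_derivative Gx t x) (at x)" "Ck n Gt" "Ck n Gx"
    using Suc.prems(2) unfolding Ck.simps by blast
  \<comment> \<open>The product rule also contains the undifferentiated factors, needed at level
    \<open>n\<close> only.\<close>
  have FG: "Ck n F" "Ck n G" using Suc.prems by (blast intro: Ck_Suc_imp)+
  show ?case
  proof (rule Ck_SucI[of _ "\<lambda>t x. F t x *\<^sub>R Gt t x + Ft t x *\<^sub>R G t x"
        "\<lambda>t x. F t x *\<^sub>R Gx t x + Fx t x *\<^sub>R G t x"])
    show "continuous_on UNIV (\<lambda>p. F (fst p) (snd p) *\<^sub>R G (fst p) (snd p))"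
      using Suc.prems[THEN Ck_continuous] by (intro continuous_intros)
    show "((\<lambda>s. F s x *\<^sub>R G s x) has_vector_derivative F t x *\<^sub>R Gt t x + Ft t x *\<^sub>R G t x) (at t)" for t x
      using has_vector_derivative_scaleR F(1) G(1) unfolding has_real_derivative_iff_has_vector_derivative by blast
    show "((\<lambda>y. F t y *\<^sub>R G t y) has_vector_derivative F t x *\<^sub>R Gx t x + Fx t x *\<^sub>R G t x) (at x)" for t x
      using has_vector_derivative_scaleR F(2) G(2) unfolding has_real_derivative_iff_has_vector_derivative by blast
  qed (intro Ck_add Suc.IH F G FG)+
qed

text \<open>Differentiating \<open>1 / F\<close> reproduces \<open>1 / F\<close>, but only at level
  \<open>n\<close>, where the induction hypothesis supplies it.\<close>

lemma Ck_inverse: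
  fixes F :: "real \<Rightarrow> real \<Rightarrow> real"
  assumes "Ck n F" and nz: "\<And>t x. F t x \<noteq> 0"
  shows "Ck n (\<lambda>t x. inverse (F t x))"
  using assms(1)
proof (induction n)
  case 0
  then show ?case using nz by (auto intro!: continuous_intros)
next
  case (Suc n)
  obtain Ft Fx where F: "\<And>t x. ((\<lambda>s. F s x) has_vector_derivative Ft t x) (at t)"
    "\<And>t x. (F t has_vector_derivative Fx t x) (at x)" "Ck n Ft" "Ck n Fx"
    using Suc.prems(1) unfolding Ck.simps by blast
  let ?I = "\<lambda>t x. inverse (F t x)"
  have I: "Ck n ?I" using Suc Ck_Suc_imp by blast
  show ?case
  proof (rule Ck_SucI[of _ "\<lambda>t x. -1 *\<^sub>R (?I t x *\<^sub>R Ft t x *\<^sub>R ?I t x)"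
        "\<lambda>t x. -1 *\<^sub>R (?I t x *\<^sub>R Fx t x *\<^sub>R ?I t x)"])
    show "continuous_on UNIV (\<lambda>p. inverse (F (fst p) (snd p)))"
      using Suc.prems[THEN Ck_continuous] nz by (intro continuous_intros) auto
    show "((\<lambda>s. inverse (F s x)) has_vector_derivative -1 *\<^sub>R (?I t x *\<^sub>R Ft t x *\<^sub>R ?I t x)) (at t)" for t x
      using DERIV_inverse'[OF F(1)[of x t, folded has_real_derivative_iff_has_vector_derivative] nz]
      unfolding has_real_derivative_iff_has_vector_derivative by (simp add: mult.assoc)
    show "((\<lambda>y. inverse (F t y)) has_vector_derivative -1 *\<^sub>R (?I t x *\<^sub>R Fx t x *\<^sub>R ?I t x)) (at x)" for t x
      using DERIV_inverse'[OF F(2)[of t x, folded has_real_derivative_iff_has_vector_derivative] nz]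
      unfolding has_real_derivative_iff_has_vector_derivative by (simp add: mult.assoc)
  qed (intro Ck_scaleR Ck_const I F)+
qed

section \<open>Smooth functions of one variable and composition with them\<close>

lemma smooth_D: "smooth f \<Longrightarrow> smooth (D f)"
  unfolding smooth_def by (metis comp_apply funpow_Suc_right)

lemma smooth_has_vector_derivative: "smooth f \<Longrightarrow> (f has_vector_derivative D f x) (at x)"
  unfolding smooth_def D_def by (metis funpow_0 vector_derivative_works)

lemma D_eqI: "(\<And>x. (f has_vector_derivative g x) (at x)) \<Longrightarrow> D f = g"
  unfolding D_def using vector_derivative_at by blast

text \<open>A guessed formula for all derivatives identifies the iterates of \<open>D\<close>; it
  serves for slices, parameter integrals, \<open>sin\<close> and \<open>cis\<close>.\<close>

lemma smooth_sequenceI: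
  assumes "\<And>k x. (F k has_vector_derivative F (Suc k) x) (at x)"
  shows "smooth (F 0)"
proof -
  have "(D ^^ k) (F 0) = F k" for k
    by (induction k) (auto intro!: D_eqI assms)
  then show ?thesis unfolding smooth_def
    using differentiableI_vector[OF assms] by simp
qed

lemma smooth_continuous: "smooth f \<Longrightarrow> continuous_on UNIV f"
  by (meson continuous_at_imp_continuous_on has_vector_derivative_continuous smooth_has_vector_derivative)

text \<open>The outer function varies in the induction, since the chain rule passes from
  \<open>f\<close> to \<open>D f\<close>.\<close>

lemma Ck_compose:
  assumes "smooth f" "Ck n G" shows "Ck n (\<lambda>t x. f (G t x))"
  using assms
proof (induction n arbitrary: f)
  case 0
  then show ?case using continuous_on_compose2[OF smooth_continuous[OF \<open>smooth f\<close>]] by auto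
next
  case (Suc n)
  obtain Gt Gx where G: "\<And>t x. ((\<lambda>s. G s x) has_vector_derivative Gt t x) (at t)"
    "\<And>t x. (G t has_vector_derivative Gx t x) (at x)" "Ck n Gt" "Ck n Gx"
    using Suc.prems(2) unfolding Ck.simps by blast
  have DG: "Ck n (\<lambda>t x. D f (G t x))"
    using Suc.IH smooth_D Suc.prems Ck_Suc_imp by blast
  show ?case
  proof (rule Ck_SucI[of _ "\<lambda>t x. Gt t x *\<^sub>R D f (G t x)" "\<lambda>t x. Gx t x *\<^sub>R D f (G t x)"])
    show "continuous_on UNIV (\<lambda>p. f (G (fst p) (snd p)))"
      using continuous_on_compose2[OF smooth_continuous[OF \<open>smooth f\<close>]] Ck_continuous[OF Suc.prems(2)] by auto
    show "((\<lambda>s. f (G s x)) has_vector_derivative Gt t x *\<^sub>R D f (G t x)) (at t)" for t x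
      using vector_diff_chain_at[OF G(1) smooth_has_vector_derivative[OF Suc.prems(1)]]
      by (simp add: o_def)
    show "((\<lambda>y. f (G t y)) has_vector_derivative Gx t x *\<^sub>R D f (G t x)) (at x)" for t x
      using vector_diff_chain_at[OF G(2) smooth_has_vector_derivative[OF Suc.prems(1)]]
      by (simp add: o_def)
  qed (intro Ck_scaleR G DG)+
qed

section \<open>The partial derivatives of a jointly smooth function\<close>

lemma smooth2_has_Dt_Dx:
  assumes "smooth2 F"
  shows smooth2_has_Dt: "((\<lambda>s. F s x) has_vector_derivative Dt F t x) (at t)"
    and smooth2_has_Dx: "(F t has_vector_derivative Dx F t x) (at x)"
    and smooth2_Dt: "smooth2 (Dt F)" and smooth2_Dx: "smooth2 (Dx F)"
proof -
  have "\<forall>n. \<exists>Ft Fx. (\<forall>t x. ((\<lambda>s. F s x) has_vector_derivative Ft t x) (at t)) \<and>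
              (\<forall>t x. (F t has_vector_derivative Fx t x) (at x)) \<and> Ck n Ft \<and> Ck n Fx"
    using assms Ck.simps(2) unfolding smooth2_def by blast
  \<comment> \<open>The witnesses may a priori depend on \<open>n\<close>. Uniqueness of derivatives
    makes them all equal to \<open>Dt F\<close> and \<open>Dx F\<close>, which are therefore of
    every class.\<close>
  moreover have "Ft = Dt F" if "\<forall>t x. ((\<lambda>s. F s x) has_vector_derivative Ft t x) (at t)" for Ft
    using that unfolding Dt_def by (intro ext) (metis vector_derivative_at)
  moreover have "Fx = Dx F" if "\<forall>t x. (F t has_vector_derivative Fx t x) (at x)" for Fx
    using that unfolding Dx_def D_def by (intro ext) (metis vector_derivative_at)
  ultimately have *: "\<forall>n. (\<forall>t x. ((\<lambda>s. F s x) has_vector_derivative Dt F t x) (at t)) \<and>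
              (\<forall>t x. (F t has_vector_derivative Dx F t x) (at x)) \<and> Ck n (Dt F) \<and> Ck n (Dx F)"
    by metis
  then show "((\<lambda>s. F s x) has_vector_derivative Dt F t x) (at t)"
    "(F t has_vector_derivative Dx F t x) (at x)" "smooth2 (Dt F)" "smooth2 (Dx F)"
    unfolding smooth2_def by auto
qed

lemma Dt_eqI: "(\<And>t x. ((\<lambda>s. F s x) has_vector_derivative G t x) (at t)) \<Longrightarrow> Dt F = G"
  unfolding Dt_def by (intro ext) (metis vector_derivative_at)

lemma Dx_eqI: "(\<And>t x. (F t has_vector_derivative G t x) (at x)) \<Longrightarrow> Dx F = G"
  unfolding Dx_def D_def by (intro ext) (metis vector_derivative_at)

lemma smooth2_continuous: "smooth2 F \<Longrightarrow> continuous_on UNIV (\<lambda>p. F (fst p) (snd p))"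
  unfolding smooth2_def using Ck.simps(1) by blast

lemma smooth2_continuous_x: "smooth2 F \<Longrightarrow> continuous_on S (F t)"
  using continuous_on_compose2[OF smooth2_continuous, of F S "\<lambda>x. (t, x)"]
  by (simp add: continuous_on_Pair)

lemma smooth2I:
  assumes "continuous_on UNIV (\<lambda>p. F (fst p) (snd p))"
    "\<And>t x. ((\<lambda>s. F s x) has_vector_derivative Ft t x) (at t)"
    "\<And>t x. (F t has_vector_derivative Fx t x) (at x)" "smooth2 Ft" "smooth2 Fx"
  shows "smooth2 F"
  unfolding smooth2_def
proof
  fix n show "Ck n F"
    using assms Ck_SucI[OF assms(1-3)] unfolding smooth2_def by (cases n) auto
qed

section \<open>Closure rules for joint smoothness\<close>

named_theorems smooth2_intros

lemma smooth2_const [smooth2_intros]: "smooth2 (\<lambda>t x. c)"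
  and smooth2_fst [smooth2_intros]: "smooth2 (\<lambda>t x. t)"
  and smooth2_snd [smooth2_intros]: "smooth2 (\<lambda>t x. x)"
  and smooth2_add [smooth2_intros]: "smooth2 F \<Longrightarrow> smooth2 G \<Longrightarrow> smooth2 (\<lambda>t x. F t x + G t x)"
  and smooth2_scaleR [smooth2_intros]: "smooth2 r \<Longrightarrow> smooth2 F \<Longrightarrow> smooth2 (\<lambda>t x. r t x *\<^sub>R F t x)"
  and smooth2_compose: "smooth f \<Longrightarrow> smooth2 r \<Longrightarrow> smooth2 (\<lambda>t x. f (r t x))"
  and smooth2_inverse [smooth2_intros]:
    "smooth2 q \<Longrightarrow> (\<And>t x. q t x \<noteq> (0::real)) \<Longrightarrow> smooth2 (\<lambda>t x. inverse (q t x))"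
  unfolding smooth2_def
  by (auto intro: Ck_const Ck_fst Ck_snd Ck_add Ck_scaleR Ck_compose Ck_inverse)

lemma smooth2_mult [smooth2_intros]:
  "smooth2 F \<Longrightarrow> smooth2 G \<Longrightarrow> smooth2 (\<lambda>t x. F t x * G t x :: real)"
  using smooth2_scaleR[of F G] by simp

lemma smooth2_minus [smooth2_intros]: "smooth2 F \<Longrightarrow> smooth2 (\<lambda>t x. - F t x)"
  using smooth2_scaleR[of "\<lambda>t x. -1" F] by (simp add: smooth2_const)

lemma smooth2_diff [smooth2_intros]: "smooth2 F \<Longrightarrow> smooth2 G \<Longrightarrow> smooth2 (\<lambda>t x. F t x - G t x)"
  using smooth2_add[of F "\<lambda>t x. - G t x"] by (simp add: smooth2_minus)

lemma smooth2_divide [smooth2_intros]: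
  "smooth2 F \<Longrightarrow> smooth2 q \<Longrightarrow> (\<And>t x. q t x \<noteq> 0) \<Longrightarrow> smooth2 (\<lambda>t x. F t x / q t x :: real)"
  unfolding divide_inverse by (intro smooth2_intros)

lemma smooth2_power [smooth2_intros]: "smooth2 F \<Longrightarrow> smooth2 (\<lambda>t x. F t x ^ n :: real)"
  by (induction n) (auto intro: smooth2_intros)

lemma smooth2_sum [smooth2_intros]:
  "(\<And>i. i \<in> I \<Longrightarrow> smooth2 (F i)) \<Longrightarrow> smooth2 (\<lambda>t x. \<Sum>i\<in>I. F i t x)"
  by (induction I rule: infinite_finite_induct) (auto intro: smooth2_intros)

lemma smooth2_ln [smooth2_intros]:
  assumes "smooth2 F" and pos: "\<And>t x. (0::real) < F t x"
  shows "smooth2 (\<lambda>t x. ln (F t x))"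
proof (rule smooth2I)
  show "continuous_on UNIV (\<lambda>p. ln (F (fst p) (snd p)))"
    using pos smooth2_continuous[OF assms(1)] by (intro continuous_intros) (auto simp: less_imp_neq[OF pos, symmetric])
  show "((\<lambda>s. ln (F s x)) has_vector_derivative Dt F t x / F t x) (at t)"
    "((\<lambda>y. ln (F t y)) has_vector_derivative Dx F t x / F t x) (at x)" for t x
    using DERIV_chain2[OF DERIV_ln_divide[OF pos] smooth2_has_Dt[OF assms(1), folded has_real_derivative_iff_has_vector_derivative]]
     DERIV_chain2[OF DERIV_ln_divide[OF pos] smooth2_has_Dx[OF assms(1), folded has_real_derivative_iff_has_vector_derivative]]
    unfolding has_real_derivative_iff_has_vector_derivative by (simp_all add: field_simps)
  show "smooth2 (\<lambda>t x. Dt F t x / F t x)" "smooth2 (\<lambda>t x. Dx F t x / F t x)"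
    using less_imp_neq[OF pos, symmetric] by (intro smooth2_intros smooth2_Dt smooth2_Dx assms; simp)+
qed

section \<open>Restriction to lines, and symmetry of the mixed partial derivatives\<close>

lemma smooth2_slice_x: assumes "smooth2 F" shows "smooth (F t)"
proof -
  have "smooth2 ((Dx ^^ k) F)" for k
    by (induction k) (auto intro: assms smooth2_Dx)
  then show ?thesis
    using smooth_sequenceI[of "\<lambda>k. (Dx ^^ k) F t"] smooth2_has_Dx by auto
qed

lemma smooth2_slice_t: assumes "smooth2 F" shows "smooth (\<lambda>t. F t x)"
proof -
  have "smooth2 ((Dt ^^ k) F)" for k
    by (induction k) (auto intro: assms smooth2_Dt)
  then show ?thesis
    using smooth_sequenceI[of "\<lambda>k t. (Dt ^^ k) F t x"] smooth2_has_Dt by auto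
qed

lemma smooth2_of_smooth: "smooth f \<Longrightarrow> smooth2 (\<lambda>t x. f x)" "smooth f \<Longrightarrow> smooth2 (\<lambda>t x. f t)"
  using smooth2_compose[OF _ smooth2_snd] smooth2_compose[OF _ smooth2_fst] by blast+

text \<open>Through this equivalence the rules \<open>smooth2_intros\<close> also prove smoothness
  in one variable.\<close>

lemma smooth_iff_smooth2: "smooth f \<longleftrightarrow> smooth2 (\<lambda>t x. f x)"
  using smooth2_of_smooth(1) smooth2_slice_x by blast

lemma smooth_antiderivative:
  assumes "\<And>x. (f has_vector_derivative g x) (at x)" "smooth g"
  shows "smooth f"
proof -
  have "\<And>x. D f x = g x" using D_eqI[of f g] assms by auto
  then have "(D ^^ Suc k) f = (D ^^ k) g" for k
    by (simp only: funpow_Suc_right comp_apply) (metis ext)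
  then have "(D ^^ k) f differentiable at x" for k x
    using assms unfolding smooth_def by (cases k) (auto simp del: funpow.simps simp: intro: differentiableI_vector)
  then show ?thesis unfolding smooth_def by blast
qed

text \<open>Differentiate \<open>F t y - F t a = integral {a..y} (Dx F t)\<close> under the integral sign.\<close>

lemma Dt_Dx_commute:
  assumes F: "smooth2 F" shows "Dx (Dt F) = Dt (Dx F)"
proof -
  have step: "(Dt F t has_vector_derivative Dt (Dx F) t x) (at x)" for t x
  proof -
    \<comment> \<open>The base point lies strictly left of \<open>x\<close>, so that
      \<open>x\<close> is interior to \<open>{a..x+1}\<close> and the derivative of the integral is
      two-sided.\<close>
    define a where "a = x - 1"
    have *: "Dt F t y - Dt F t a = integral {a..y} (Dt (Dx F) t)" if "a \<le> y" for y
    proof -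
      have "((\<lambda>s. integral (cbox a y) (Dx F s)) has_vector_derivative integral (cbox a y) (Dt (Dx F) t)) (at t within UNIV)"
      proof (rule leibniz_rule_vector_derivative)
        show "((\<lambda>s. Dx F s z) has_vector_derivative Dt (Dx F) s z) (at s within UNIV)" for s z
          using smooth2_has_Dt smooth2_Dx F by blast
        show "Dx F s integrable_on cbox a y" for s
          by (intro integrable_continuous smooth2_continuous_x smooth2_Dx F)
        show "continuous_on (UNIV \<times> cbox a y) (\<lambda>(x, y). Dt (Dx F) x y)"
          using smooth2_continuous[OF smooth2_Dt[OF smooth2_Dx[OF F]]]
          by (auto simp: split_beta elim: continuous_on_subset)
      qed auto
      moreover have "integral (cbox a y) (Dx F s) = F s y - F s a" for s
        using fundamental_theorem_of_calculus[OF that, of "F s" "Dx F s"] smooth2_has_Dx[OF F]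
        by (auto simp: has_vector_derivative_at_within dest: integral_unique)
      ultimately have "((\<lambda>s. F s y - F s a) has_vector_derivative integral {a..y} (Dt (Dx F) t)) (at t)"
        by simp
      moreover have "((\<lambda>s. F s y - F s a) has_vector_derivative Dt F t y - Dt F t a) (at t)"
        by (intro derivative_intros smooth2_has_Dt F)
      ultimately show ?thesis by (metis vector_derivative_at)
    qed
    have "((\<lambda>y. integral {a..y} (Dt (Dx F) t)) has_vector_derivative Dt (Dx F) t x) (at x within {a..x+1})"
      by (rule integral_has_vector_derivative)
        (auto simp: a_def intro!: smooth2_continuous_x smooth2_Dx smooth2_Dt F)
    then have "((\<lambda>y. integral {a..y} (Dt (Dx F) t)) has_vector_derivative Dt (Dx F) t x) (at x)"
      by (subst (asm) at_within_interior) (auto simp: a_def)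
    from has_vector_derivative_add[OF has_vector_derivative_const this]
    have "((\<lambda>y. Dt F t a + integral {a..y} (Dt (Dx F) t)) has_vector_derivative Dt (Dx F) t x) (at x)"
      by simp
    then show ?thesis
    proof (rule has_vector_derivative_transform_within_open[where S = "{a<..}"])
      show "x \<in> {a<..}" by (simp add: a_def)
      show "Dt F t a + integral {a..y} (Dt (Dx F) t) = Dt F t y" if "y \<in> {a<..}" for y
        using *[of y] that by (simp add: algebra_simps)
    qed simp
  qed
  then show ?thesis by (intro Dx_eqI)
qed

section \<open>Curves of smooth functions and diffeomorphisms of the line\<close>

lemma periodic_int:
  fixes f :: "real \<Rightarrow> 'a::ab_group_add"
  assumes "\<And>x. f (x + 2 * pi) = f x"
  shows "f (x + 2 * pi * of_int k) = f x"
proof (induction k rule: int_induct[of _ 0])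
  case (step1 i)
  then show ?case using assms[of "x + 2 * pi * of_int i"] by (simp add: algebra_simps)
next
  case (step2 i)
  then show ?case using assms[of "x + 2 * pi * of_int (i - 1)"] by (simp add: algebra_simps)
qed auto

lemma period_representative:
  obtains k :: int where "x + 2 * pi * of_int k \<in> {0..2 * pi}"
proof -
  let ?k = "- \<lfloor>x / (2 * pi)\<rfloor>"
  have "2 * pi * of_int \<lfloor>x / (2 * pi)\<rfloor> \<le> 2 * pi * (x / (2 * pi))"
    "2 * pi * (x / (2 * pi)) \<le> 2 * pi * (of_int \<lfloor>x / (2 * pi)\<rfloor> + 1)"
    by (intro mult_left_mono; linarith?; simp)+
  then have "x + 2 * pi * of_int ?k \<in> {0..2 * pi}"
    by (simp add: algebra_simps)
  then show ?thesis by (rule that)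
qed

lemma vector_derivative_shift:
  assumes f: "\<And>x. (f has_vector_derivative f' x) (at x)" and K: "\<And>x. f (x + c) = f x + K"
  shows "f' (x + c) = f' x"
proof -
  have "((\<lambda>y. f (y + c)) has_vector_derivative f' (x + c)) (at x)"
    using vector_diff_chain_at[OF has_vector_derivative_add[OF has_vector_derivative_id has_vector_derivative_const], of f "f' (x + c)" x c]
      f[of "x + c"] by (simp add: o_def)
  moreover have "((\<lambda>y. f (y + c)) has_vector_derivative f' x) (at x)"
    unfolding K using has_vector_derivative_add[OF f has_vector_derivative_const] by simp
  ultimately show ?thesis by (metis vector_derivative_at)
qed

lemma Dx_periodic:
  "smooth2 F \<Longrightarrow> (\<And>x. F t (x + c) = F t x + K) \<Longrightarrow> Dx F t (x + c) = Dx F t x"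
  by (rule vector_derivative_shift[where f = "F t"]) (rule smooth2_has_Dx)

lemma Dt_periodic:
  assumes "smooth2 F" "\<And>t x. F t (x + c) = F t x + K" shows "Dt F t (x + c) = Dt F t x"
proof -
  have "((\<lambda>t. F t (x + c)) has_vector_derivative Dt F t x) (at t)"
    unfolding assms(2)
    using has_vector_derivative_add[OF smooth2_has_Dt[OF assms(1)] has_vector_derivative_const] by simp
  then show ?thesis by (metis smooth2_has_Dt assms(1) vector_derivative_at)
qed

section \<open>Frechet derivatives of curves given by jointly smooth functions\<close>

lemma D_funpow_slice: "(D ^^ k) (F t) = (Dx ^^ k) F t"
  by (induction k) (auto simp: Dx_def)

lemma smooth2_Dx_funpow: "smooth2 F \<Longrightarrow> smooth2 ((Dx ^^ k) F)"
  by (induction k) (auto intro: smooth2_Dx)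

lemma smooth2_Dt_funpow: "smooth2 F \<Longrightarrow> smooth2 ((Dt ^^ k) F)"
  by (induction k) (auto intro: smooth2_Dt)

lemma Dx_funpow_Dt: "smooth2 F \<Longrightarrow> (Dx ^^ k) (Dt F) = Dt ((Dx ^^ k) F)"
  by (induction k) (auto simp: Dt_Dx_commute smooth2_Dx_funpow)

text \<open>\<open>Dt G\<close> is uniformly continuous on a compact window of one period, and
  periodicity extends the estimate to the line; the mean value inequality carries it over to the
  quotients. Only \<open>Dt G\<close> has to be periodic, as \<open>G\<close> may gain a constant
  over a period.\<close>

lemma smooth2_difference_quotient_uniform_limit:
  assumes G: "smooth2 G" and per: "\<And>t x. Dt G t (x + 2 * pi) = Dt G t x"
  shows "uniform_limit UNIV (\<lambda>s x. (G s x - G t x) /\<^sub>R (s - t)) (Dt G t) (at t within S)"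
proof (rule uniform_limitI)
  fix e :: real assume "e > 0"
  let ?K = "{t - 1..t + 1} \<times> {0..2 * pi}"
  have "uniformly_continuous_on ?K (\<lambda>p. Dt G (fst p) (snd p))"
    by (intro compact_uniformly_continuous compact_Times compact_Icc
        continuous_on_subset[OF smooth2_continuous[OF smooth2_Dt[OF G]]]) auto
  then obtain d where d: "d > 0" "\<And>p q. p \<in> ?K \<Longrightarrow> q \<in> ?K \<Longrightarrow> dist q p < d \<Longrightarrow>
      dist (Dt G (fst q) (snd q)) (Dt G (fst p) (snd p)) < e / 2"
    using \<open>e > 0\<close> unfolding uniformly_continuous_on_def by (metis half_gt_zero)
  have near: "norm (Dt G s x - Dt G t x) \<le> e / 2" if s: "\<bar>s - t\<bar> < min d 1" for s x
  proof -
    obtain k :: int where k: "x + 2 * pi * of_int k \<in> {0..2 * pi}" by (rule period_representative)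
    have "t - 1 \<le> s" "s \<le> t + 1" using s by linarith+
    have "dist (Dt G s (x + 2 * pi * of_int k)) (Dt G t (x + 2 * pi * of_int k)) < e / 2"
      using d(2)[of "(t, x + 2 * pi * of_int k)" "(s, x + 2 * pi * of_int k)"] s k
      \<open>t - 1 \<le> s\<close> \<open>s \<le> t + 1\<close> by (auto simp: dist_Pair_Pair dist_real_def)
    then show ?thesis using per by (simp add: periodic_int dist_norm)
  qed
  have "dist ((G s x - G t x) /\<^sub>R (s - t)) (Dt G t x) < e" if s: "s \<noteq> t" "\<bar>s - t\<bar> < min d 1" for s x
  proof -
    have "norm (G s x - G t x - (s - t) *\<^sub>R Dt G t x) \<le> norm (s - t) * (e / 2)"
      by (rule vector_differentiable_bound_linearization[where S = "ball t (min d 1)" and f' = "\<lambda>s. Dt G s x"])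
        (use s near d in \<open>auto simp: dist_real_def abs_minus_commute convex_contains_segment[THEN iffD1, OF convex_ball]
          intro!: has_vector_derivative_at_within smooth2_has_Dt G closed_segment_subset\<close>)
    moreover have "(G s x - G t x) /\<^sub>R (s - t) - Dt G t x = (G s x - G t x - (s - t) *\<^sub>R Dt G t x) /\<^sub>R (s - t)"
      using s by (simp add: scaleR_diff_right)
    ultimately have "norm ((G s x - G t x) /\<^sub>R (s - t) - Dt G t x) \<le> inverse \<bar>s - t\<bar> * (norm (s - t) * (e / 2))"
      by (simp only: norm_scaleR abs_inverse) (intro mult_left_mono; simp)
    then have "norm ((G s x - G t x) /\<^sub>R (s - t) - Dt G t x) \<le> e / 2"
      using s by (simp flip: mult.assoc)
    then show ?thesis using \<open>e > 0\<close> by (simp add: dist_norm)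
  qed
  moreover have "\<forall>\<^sub>F s in at t within S. s \<noteq> t \<and> \<bar>s - t\<bar> < min d 1"
    using d(1) unfolding eventually_at by (intro exI[of _ "min d 1"]) (auto simp: dist_real_def)
  ultimately show "\<forall>\<^sub>F s in at t within S. \<forall>x\<in>UNIV. dist ((G s x - G t x) /\<^sub>R (s - t)) (Dt G t x) < e"
    by (auto elim!: eventually_mono)
qed

text \<open>The constant \<open>K\<close> is \<open>2 * pi\<close> for diffeomorphisms of the line
  and 0 for their images under \<open>cis\<close>. Since \<open>Dx\<close> and \<open>Dt\<close>
  commute, the order \<open>k\<close> condition is the uniform limit for
  \<open>(Dx ^^ k) F\<close>.\<close>

lemma smooth2_has_Cinf_derivative:
  assumes F: "smooth2 F" and K: "\<And>t x. F t (x + 2 * pi) = F t x + K"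
  shows "has_Cinf_derivative F (Dt F t) t"
  unfolding has_Cinf_derivative_def
proof
  fix k
  have "\<exists>K. \<forall>t x. (Dx ^^ k) F t (x + 2 * pi) = (Dx ^^ k) F t x + K"
  proof (induction k)
    case (Suc k)
    then show ?case
      using Dx_periodic[OF smooth2_Dx_funpow[OF F, of k]] by (intro exI[of _ 0]) auto
  qed (use K in auto)
  then show "uniform_limit UNIV (\<lambda>s \<theta>. ((D ^^ k) (F s) \<theta> - (D ^^ k) (F t) \<theta>) /\<^sub>R (s - t))
      ((D ^^ k) (Dt F t)) (at t within {0..1})"
    unfolding D_funpow_slice Dx_funpow_Dt[OF F]
    using smooth2_difference_quotient_uniform_limit[OF smooth2_Dx_funpow[OF F]]
      Dt_periodic[OF smooth2_Dx_funpow[OF F]] by blast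
qed

lemma smooth2_smooth_Cinf_curve:
  assumes F: "smooth2 F" and K: "\<And>t x. F t (x + 2 * pi) = F t x + K"
  shows "smooth_Cinf_curve F"
proof -
  have "\<exists>K. \<forall>t x. (Dt ^^ n) F t (x + 2 * pi) = (Dt ^^ n) F t x + K" for n
  proof (induction n)
    case (Suc k)
    then show ?case
      using Dt_periodic[OF smooth2_Dt_funpow[OF F, of k]] by (intro exI[of _ 0]) auto
  qed (use K in auto)
  then have "has_Cinf_derivative ((Dt ^^ n) F) (Dt ((Dt ^^ n) F) t) t" for n t
    using smooth2_has_Cinf_derivative[OF smooth2_Dt_funpow[OF F]] by blast
  then show ?thesis unfolding smooth_Cinf_curve_def
    by (intro exI[of _ "\<lambda>n. (Dt ^^ n) F"]) (auto intro: smooth2_slice_x smooth2_Dt_funpow F simp del: funpow.simps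
        simp: funpow.simps(2) o_def)
qed

section \<open>Integrals with a parameter and antiderivatives\<close>

lemma smooth2_integral_has_derivative:
  fixes F :: "real \<Rightarrow> real \<Rightarrow> 'a::euclidean_space"
  assumes F: "smooth2 F"
  shows "((\<lambda>t. integral {a..b} (F t)) has_vector_derivative integral {a..b} (Dt F t)) (at t)"
proof -
  have "((\<lambda>t. integral (cbox a b) (F t)) has_vector_derivative integral (cbox a b) (Dt F t)) (at t within UNIV)"
  proof (rule leibniz_rule_vector_derivative)
    show "((\<lambda>s. F s z) has_vector_derivative Dt F s z) (at s within UNIV)" for s z
      using smooth2_has_Dt F by blast
    show "F s integrable_on cbox a b" for s
      by (intro integrable_continuous smooth2_continuous_x F)
    show "continuous_on (UNIV \<times> cbox a b) (\<lambda>(x, y). Dt F x y)"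
      using smooth2_continuous[OF smooth2_Dt[OF F]] by (auto simp: split_beta elim: continuous_on_subset)
  qed auto
  then show ?thesis by simp
qed

lemma smooth_integral:
  fixes F :: "real \<Rightarrow> real \<Rightarrow> 'a::euclidean_space"
  assumes "smooth2 F" shows "smooth (\<lambda>t. integral {a..b} (F t))"
  using smooth_sequenceI[of "\<lambda>k t. integral {a..b} ((Dt ^^ k) F t)"]
    smooth2_integral_has_derivative[OF smooth2_Dt_funpow[OF assms]] by auto

lemma smooth_has_antiderivative:
  fixes g :: "real \<Rightarrow> 'a::euclidean_space"
  assumes "smooth g"
  obtains f where "smooth f" "\<And>x. (f has_vector_derivative g x) (at x)" "f a = c"
proof -
  have "isCont g x" for x
    using smooth_continuous[OF assms] by (simp add: continuous_on_eq_continuous_at)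
  then obtain f where f: "\<And>x. (f has_vector_derivative g x) (at x)"
    using einterval_antiderivative[of "- \<infinity>" "\<infinity>" g] by auto
  then have "\<And>x. ((\<lambda>x. f x + (c - f a)) has_vector_derivative g x) (at x)"
    using has_vector_derivative_add[OF _ has_vector_derivative_const] by fastforce
  then show ?thesis using that[of "\<lambda>x. f x + (c - f a)"] smooth_antiderivative assms by fastforce
qed

lemma smooth_imp_smooth_real_curve: "smooth b \<Longrightarrow> smooth_real_curve b"
  unfolding smooth_real_curve_def
  by (intro exI[of _ "\<lambda>n. (D ^^ n) b"])
    (auto simp: smooth_def D_def has_real_derivative_iff_has_vector_derivative
      intro!: has_vector_derivative_at_within vector_derivative_works[THEN iffD1])

lemma smooth_has_real_derivative: "smooth f \<Longrightarrow> (f has_real_derivative D f x) (at x)"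
  by (simp add: has_real_derivative_iff_has_vector_derivative smooth_has_vector_derivative)

lemma smooth_deriv: "smooth f \<Longrightarrow> deriv f = D f"
  using DERIV_imp_deriv smooth_has_real_derivative by blast

section \<open>Diffeomorphisms of the line that commute with the period\<close>

lemma quasi_periodic_int:
  fixes \<phi> :: "real \<Rightarrow> real"
  assumes "\<And>x. \<phi> (x + 2 * pi) = \<phi> x + 2 * pi"
  shows "\<phi> (x + 2 * pi * of_int k) = \<phi> x + 2 * pi * of_int k"
  using periodic_int[of "\<lambda>x. \<phi> x - x" x k] assms by simp

lemma positive_derivative_less_iff:
  fixes \<phi> :: "real \<Rightarrow> real"
  assumes "smooth \<phi>" "\<And>x. 0 < D \<phi> x"
  shows "\<phi> x < \<phi> y \<longleftrightarrow> x < (y::real)"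
proof -
  have "\<phi> x < \<phi> y" if "x < y" for x y
    using DERIV_pos_imp_increasing[OF that] smooth_has_real_derivative[OF assms(1)] assms(2) by blast
  then show ?thesis by (metis linorder_less_linear order_less_asym)
qed

lemma DiffR_I:
  assumes sm: "smooth \<phi>" and pos: "\<And>x. 0 < D \<phi> x" and per: "\<And>x. \<phi> (x + 2 * pi) = \<phi> x + 2 * pi"
  shows "\<phi> \<in> carrier DiffR"
proof -
  have "inj \<phi>"
    using positive_derivative_less_iff[OF sm pos] by (metis injI linorder_less_linear order_less_irrefl)
  moreover have "surj \<phi>"
    unfolding surj_def
  proof
    fix y
    \<comment> \<open>Two consecutive multiples of the period have images enclosing
      \<open>y\<close>, so the intermediate value theorem gives a preimage.\<close>
    obtain k :: int where k: "(y - \<phi> 0) + 2 * pi * of_int k \<in> {0..2 * pi}" by (rule period_representative)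
    have "\<phi> (0 + 2 * pi * of_int (-k)) \<le> y" "y \<le> \<phi> (0 + 2 * pi * of_int (1 - k))"
      unfolding quasi_periodic_int[of \<phi>, OF per] using k by (auto simp: algebra_simps)
    then have "\<exists>x\<ge>0 + 2 * pi * of_int (-k). x \<le> 0 + 2 * pi * of_int (1 - k) \<and> \<phi> x = y"
      by (intro IVT' continuous_on_subset[OF smooth_continuous[OF sm]]) (auto simp: algebra_simps)
    then show "\<exists>x. y = \<phi> x" by blast
  qed
  ultimately have "bij \<phi>" by (simp add: bij_def)
  define g where "g = inv_into UNIV \<phi>"
  have g: "\<phi> (g y) = y" "g (\<phi> y) = y" for y
    unfolding g_def using \<open>bij \<phi>\<close> by (simp_all add: bij_is_inj bij_is_surj surj_f_inv_f)
  have dg: "(g has_vector_derivative inverse (D \<phi> (g y))) (at y)" for y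
  proof -
    have "(g has_derivative (*) (inverse (D \<phi> (g y)))) (at (\<phi> (g y)))"
    proof (rule has_derivative_inverse_strong[of UNIV "g y" \<phi>])
      show "(\<phi> has_derivative (*) (D \<phi> (g y))) (at (g y))"
        using smooth_has_real_derivative[OF sm] by (simp add: has_field_derivative_def)
      show "(*) (D \<phi> (g y)) \<circ> (*) (inverse (D \<phi> (g y))) = id"
        using pos[of "g y"] by (auto simp: fun_eq_iff)
    qed (use g smooth_continuous[OF sm] in auto)
    then show ?thesis
      by (simp add: g has_field_derivative_def flip: has_real_derivative_iff_has_vector_derivative)
  qed
  have sd: "smooth (\<lambda>x. inverse (D \<phi> x))"
    unfolding smooth_iff_smooth2 using pos smooth_D[OF sm, unfolded smooth_iff_smooth2]
    by (intro smooth2_intros) (auto simp: less_imp_neq[symmetric])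
  have cg: "continuous_on UNIV g"
    by (meson continuous_at_imp_continuous_on dg has_vector_derivative_continuous)
  \<comment> \<open>Bootstrapping: the derivative of \<open>g\<close> is a smooth function of
    \<open>g\<close>, so class \<open>n\<close> of \<open>g\<close> yields class
    \<open>n + 1\<close>.\<close>
  have "Ck n (\<lambda>t y. g y)" for n
  proof (induction n)
    case 0
    then show ?case using continuous_on_compose2[OF cg continuous_on_snd[OF continuous_on_id], of UNIV] by simp
  next
    case (Suc n)
    have "Ck n (\<lambda>t y. inverse (D \<phi> (g y)))"
      by (intro Ck_compose[OF sd] Suc)
    then show ?case using Suc dg Ck_const[of n 0]
      by (intro Ck_SucI[of _ "\<lambda>_ _. 0"]) (auto dest: Ck_continuous)
  qed
  then have "smooth g" unfolding smooth_iff_smooth2 smooth2_def by blast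
  then show ?thesis
    unfolding DiffR_def using \<open>bij \<phi>\<close> sm pos per by (simp add: g_def smooth_deriv)
qed

lemma DiffR_D:
  assumes "\<phi> \<in> carrier DiffR"
  shows "bij \<phi>" "smooth \<phi>" "smooth (inv_into UNIV \<phi>)" "0 < D \<phi> x" "\<phi> (x + 2 * pi) = \<phi> x + 2 * pi"
    "\<phi> (inv_into UNIV \<phi> x) = x" "inv_into UNIV \<phi> (\<phi> x) = x"
proof -
  show *: "bij \<phi>" "smooth \<phi>" "smooth (inv_into UNIV \<phi>)" "\<phi> (x + 2 * pi) = \<phi> x + 2 * pi"
    using assms by (auto simp: DiffR_def)
  show "0 < D \<phi> x" using assms smooth_deriv[OF *(2)] by (auto simp: DiffR_def)
  show "\<phi> (inv_into UNIV \<phi> x) = x" "inv_into UNIV \<phi> (\<phi> x) = x"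
    using *(1) by (simp_all add: bij_is_inj bij_is_surj surj_f_inv_f)
qed

lemma DiffR_inv_into_shift:
  assumes "\<phi> \<in> carrier DiffR" shows "inv_into UNIV \<phi> (x + 2 * pi) = inv_into UNIV \<phi> x + 2 * pi"
  using DiffR_D(7)[OF assms, of "inv_into UNIV \<phi> x + 2 * pi"]
    DiffR_D(5)[OF assms, of "inv_into UNIV \<phi> x"] DiffR_D(6)[OF assms, of x] by simp

lemma DiffR_inverse_has_derivative:
  assumes "\<phi> \<in> carrier DiffR"
  shows "D (inv_into UNIV \<phi>) (\<phi> x) = 1 / D \<phi> x"
proof -
  note \<phi> = DiffR_D[OF assms]
  have "((\<lambda>x. inv_into UNIV \<phi> (\<phi> x)) has_real_derivative D (inv_into UNIV \<phi>) (\<phi> x) * D \<phi> x) (at x)"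
    by (intro DERIV_chain2[OF smooth_has_real_derivative smooth_has_real_derivative] \<phi>)
  then have "D (inv_into UNIV \<phi>) (\<phi> x) * D \<phi> x = 1"
    unfolding \<phi> using DERIV_unique DERIV_ident by blast
  then show ?thesis using \<phi>(4)[of x] by (simp add: field_simps)
qed

lemma DiffR_inv_into:
  assumes "\<phi> \<in> carrier DiffR" shows "inv_into UNIV \<phi> \<in> carrier DiffR"
proof (rule DiffR_I)
  note \<phi> = DiffR_D[OF assms]
  show "0 < D (inv_into UNIV \<phi>) x" for x
    using DiffR_inverse_has_derivative[OF assms, of "inv_into UNIV \<phi> x"] \<phi>(4) by (simp add: \<phi>(6))
qed (simp_all add: DiffR_D[OF assms] DiffR_inv_into_shift assms)

text \<open>The definite description in \<open>m_inv\<close> is resolved directly: a right inverse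
  of a bijection is its inverse function.\<close>

lemma DiffR_m_inv:
  assumes "\<phi> \<in> carrier DiffR" shows "inv\<^bsub>DiffR\<^esub> \<phi> = inv_into UNIV \<phi>"
proof -
  note \<phi> = DiffR_D[OF assms]
  have "y = inv_into UNIV \<phi>" if "\<phi> \<circ> y = id" for y
  proof
    show "y x = inv_into UNIV \<phi> x" for x
      using \<phi>(7)[of "y x"] fun_cong[OF that, of x] by simp
  qed
  moreover have "\<phi> \<circ> inv_into UNIV \<phi> = id" "inv_into UNIV \<phi> \<circ> \<phi> = id"
    by (simp_all only: fun_eq_iff comp_apply id_apply \<phi>(6,7) simp_thms)
  moreover have "mult DiffR = (\<circ>)" "one DiffR = id" by (simp_all add: DiffR_def)
  ultimately show ?thesis
    unfolding m_inv_def using DiffR_inv_into[OF assms]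
    by (intro the_equality conjI) (assumption | metis)+
qed

section \<open>A bump function and integrals over a period\<close>

text \<open>The functions \<open>flat k\<close> span a space that contains \<open>exp (- 1 / x)\<close> and is closed under
  differentiation.\<close>

definition flat :: "nat \<Rightarrow> real \<Rightarrow> real" where
  "flat k x = (if 0 < x then inverse x ^ k * exp (- inverse x) else 0)"

text \<open>From the right, the exponential of \<open>inverse x\<close> outgrows every power of
  it.\<close>

lemma flat_tendsto_0: "(flat k \<longlongrightarrow> 0) (at 0)"
proof (rule filterlim_split_at)
  have "((\<lambda>x. inverse x ^ k / exp (inverse x)) \<longlongrightarrow> (0::real)) (at_right 0)"
    by (rule filterlim_compose[OF tendsto_power_div_exp_0 filterlim_inverse_at_top_right])
  moreover have "\<forall>\<^sub>F x in at_right 0. inverse x ^ k / exp (inverse x) = flat k x"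
    by (auto simp: eventually_at flat_def exp_minus divide_inverse intro!: exI[of _ 1])
  ultimately show "(flat k \<longlongrightarrow> 0) (at_right 0)" by (rule Lim_transform_eventually)
  show "(flat k \<longlongrightarrow> 0) (at_left 0)"
    by (rule Lim_transform_eventually[OF tendsto_const])
      (auto simp: eventually_at flat_def intro!: exI[of _ 1])
qed

lemma flat_has_derivative:
  "(flat k has_real_derivative flat (k + 2) x - real k * flat (k + 1) x) (at x)"
proof (cases x "0::real" rule: linorder_cases)
  case less
  have "((\<lambda>_. 0) has_real_derivative 0) (at x)" by simp
  then have "(flat k has_real_derivative 0) (at x)"
    by (rule has_field_derivative_transform_within_open[where S = "{..<0}"]) (use less in \<open>auto simp: flat_def\<close>)
  then show ?thesis using less by (simp add: flat_def)
next
  case equal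
  \<comment> \<open>At 0 the difference quotient of \<open>flat k\<close> is
    \<open>flat (k + 1)\<close>.\<close>
  have "((\<lambda>y. (flat k y - flat k 0) / (y - 0)) \<longlongrightarrow> 0) (at 0)"
    using flat_tendsto_0[of "k + 1"]
    by (rule filterlim_cong[THEN iffD1, rotated -1]) (auto simp: eventually_at flat_def divide_inverse intro!: exI[of _ 1])
  then show ?thesis using equal by (simp add: has_field_derivative_iff flat_def)
next
  case greater
  have "((\<lambda>x. inverse x ^ k * exp (- inverse x)) has_real_derivative
      real k * inverse x ^ (k - 1) * (- (inverse x * inverse x)) * exp (- inverse x) +
      inverse x ^ k * (exp (- inverse x) * (inverse x * inverse x))) (at x)"
    using greater by (auto intro!: derivative_eq_intros)
  also have "real k * inverse x ^ (k - 1) * (- (inverse x * inverse x)) * exp (- inverse x) +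
      inverse x ^ k * (exp (- inverse x) * (inverse x * inverse x)) = flat (k + 2) x - real k * flat (k + 1) x"
    \<comment> \<open>The case split handles \<open>k - 1\<close> at \<open>k = 0\<close>, where the
      factor \<open>real k\<close> vanishes.\<close>
    using greater by (cases k) (simp_all add: flat_def algebra_simps power2_eq_square)
  finally have "((\<lambda>x. inverse x ^ k * exp (- inverse x)) has_real_derivative
      flat (k + 2) x - real k * flat (k + 1) x) (at x)" .
  then show ?thesis
    by (rule has_field_derivative_transform_within_open[where S = "{0<..}"]) (use greater in \<open>auto simp: flat_def\<close>)
qed

lemma smooth_flat: "smooth (flat k)"
proof -
  have cont: "continuous_on UNIV (flat k)" for k
    by (meson DERIV_continuous continuous_at_imp_continuous_on flat_has_derivative)
  have "Ck n (\<lambda>t x. flat k x)" for n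
  proof (induction n arbitrary: k)
    case 0
    then show ?case using continuous_on_compose2[OF cont continuous_on_snd[OF continuous_on_id], of UNIV] by simp
  next
    case (Suc n)
    have "Ck n (\<lambda>t x. flat (k + 2) x + (- real k) *\<^sub>R flat (k + 1) x)"
      by (intro Ck_add Ck_scaleR Ck_const Suc)
    then show ?case
      using Suc Ck_const[of n 0] flat_has_derivative[of k, unfolded has_real_derivative_iff_has_vector_derivative]
      by (intro Ck_SucI[of _ "\<lambda>_ _. 0"]) (auto intro: Ck_continuous[OF Suc])
  qed
  then show ?thesis unfolding smooth_iff_smooth2 smooth2_def by blast
qed

text \<open>The support is \<open>{-1/6..1/6}\<close>, so translates by multiples of
  \<open>1/3\<close> meet at most at end points. The factor \<open>exp 2\<close> normalises the
  value at 0 to 1.\<close>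

definition bump :: "real \<Rightarrow> real" where
  "bump t = exp 2 * flat 0 (1 + 6 * t) * flat 0 (1 - 6 * t)"

lemma smooth_bump: "smooth bump"
  unfolding smooth_iff_smooth2 bump_def by (intro smooth2_intros smooth2_compose[OF smooth_flat])

lemma bump_0: "bump 0 = 1"
  by (simp add: bump_def flat_def flip: exp_add)

lemma bump_nonneg: "0 \<le> bump t"
  by (simp add: bump_def flat_def)

lemma bump_le_1: "bump t \<le> 1"
proof (cases "\<bar>6 * t\<bar> < 1")
  case True
  define u where "u = 6 * t"
  have u: "0 < 1 + u" "0 < 1 - u" using True by (auto simp: u_def)
  have "0 < 1 - u\<^sup>2" using mult_pos_pos[OF u] by (simp add: algebra_simps power2_eq_square)
  \<comment> \<open>This sum is at least 2, so the exponent including the normalising 2 is at most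
    0.\<close>
  moreover have "inverse (1 + u) + inverse (1 - u) = 2 / (1 - u\<^sup>2)"
    using u calculation by (simp add: field_simps power2_eq_square)
  moreover have "2 \<le> 2 / (1 - u\<^sup>2)" using calculation(1) by (simp add: field_simps)
  ultimately have "2 + (- inverse (1 + u)) + (- inverse (1 - u)) \<le> 0" by linarith
  then have "exp (2 + (- inverse (1 + u)) + (- inverse (1 - u))) \<le> 1" by (simp only: exp_le_one_iff)
  then have "exp 2 * exp (- inverse (1 + u)) * exp (- inverse (1 - u)) \<le> 1" by (simp only: exp_add)
  then show ?thesis using u by (simp add: bump_def flat_def flip: u_def)
qed (auto simp: bump_def flat_def)

lemma bump_eq_0: "1 / 6 \<le> \<bar>t\<bar> \<Longrightarrow> bump t = 0"
  by (auto simp: bump_def flat_def)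

text \<open>Every zero of a nonnegative function is a minimum; this includes the boundary points of
  the support.\<close>

lemma D_bump_eq_0:
  assumes "1 / 6 \<le> \<bar>t\<bar>" shows "D bump t = 0"
  by (rule DERIV_local_min[OF smooth_has_real_derivative[OF smooth_bump], of 1])
    (auto simp: bump_eq_0[OF assms] bump_nonneg)

section \<open>Integrals over a period\<close>

lemma integral_period_shift:
  fixes f :: "real \<Rightarrow> real"
  assumes f: "smooth f" "\<And>x. f (x + p) = f x" and "0 \<le> p"
  shows "integral {0..p} (\<lambda>x. f (x - s)) = integral {0..p} f"
proof -
  obtain F where F: "\<And>x. (F has_real_derivative f x) (at x)"
    using smooth_has_antiderivative[OF f(1)] unfolding has_real_derivative_iff_has_vector_derivative by metis
  have int: "integral {0..p} (\<lambda>x. f (x - s)) = F (p - s) - F (- s)" for s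
  proof -
    have "((\<lambda>x. F (x - s)) has_real_derivative f (x - s) * 1) (at x)" for x
      by (rule DERIV_chain2[OF F]) (auto intro!: derivative_eq_intros)
    then show ?thesis
      using fundamental_theorem_of_calculus[OF \<open>0 \<le> p\<close>, of "\<lambda>x. F (x - s)" "\<lambda>x. f (x - s)"]
      by (auto simp: has_real_derivative_iff_has_vector_derivative has_vector_derivative_at_within
          intro!: integral_unique)
  qed
  \<comment> \<open>The derivative in \<open>s\<close> is \<open>f (- s) - f (p - s)\<close>, which
    vanishes by periodicity.\<close>
  have "((\<lambda>s. F (p - s) - F (- s)) has_real_derivative 0) (at s)" for s
  proof -
    have "((\<lambda>s. F (p - s) - F (- s)) has_real_derivative f (p - s) * (- 1) - f (- s) * (- 1)) (at s)"
      by (intro DERIV_diff DERIV_chain2[OF F]) (auto intro!: derivative_eq_intros)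
    then show ?thesis using f(2)[of "- s"] by (simp add: add.commute)
  qed
  then have "F (p - s) - F (- s) = F (p - 0) - F (- 0)"
    using DERIV_isconst_all[of "\<lambda>s. F (p - s) - F (- s)" s 0] by blast
  then show ?thesis using int[of s] int[of 0] by simp
qed

text \<open>Doubling the argument runs through two periods at double speed, and an antiderivative
  gains the same amount on each.\<close>

lemma integral_double_period:
  fixes f :: "real \<Rightarrow> real"
  assumes f: "smooth f" "\<And>x. f (x + p) = f x" and "0 \<le> p"
  shows "integral {0..p} (\<lambda>x. f (2 * x)) = integral {0..p} f"
proof -
  obtain F where F: "\<And>x. (F has_real_derivative f x) (at x)" and [simp]: "F 0 = 0"
    using smooth_has_antiderivative[OF f(1), of 0 0] unfolding has_real_derivative_iff_has_vector_derivative by metis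
  have ftc: "integral {0..p} (\<lambda>x. g (c + x)) = G (c + p) - G c"
    if "\<And>x. (G has_real_derivative g x) (at x)" for g G c
  proof -
    have "((\<lambda>x. G (c + x)) has_real_derivative g (c + x) * 1) (at x)" for x
      by (rule DERIV_chain2[OF that]) (auto intro!: derivative_eq_intros)
    then show ?thesis
      using fundamental_theorem_of_calculus[OF \<open>0 \<le> p\<close>, of "\<lambda>x. G (c + x)" "\<lambda>x. g (c + x)"]
      by (auto simp: has_real_derivative_iff_has_vector_derivative has_vector_derivative_at_within
          intro!: integral_unique)
  qed
  have "((\<lambda>x. F (2 * x) / 2) has_real_derivative f (2 * x) * 2 / 2) (at x)" for x
    by (intro DERIV_cdivide DERIV_chain2[OF F]) (auto intro!: derivative_eq_intros)
  from ftc[OF this, of 0] have "integral {0..p} (\<lambda>x. f (2 * x)) = F (2 * p) / 2" by simp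
  moreover have "integral {0..p} f = F p" using ftc[OF F, of 0] by simp
  moreover have "integral {0..p} f = F (2 * p) - F p" using ftc[OF F, of p] f(2) by (simp add: add.commute)
  ultimately show ?thesis by simp
qed

lemma integral_continuous_pos:
  fixes f :: "real \<Rightarrow> real"
  assumes "continuous_on {a..b} f" "\<And>x. x \<in> {a..b} \<Longrightarrow> 0 \<le> f x" "c \<in> {a..b}" "0 < f c" "a < b"
  shows "0 < integral {a..b} f"
proof -
  have "f integrable_on {a..b}" using assms(1) by (rule integrable_continuous_real)
  then have "0 \<le> integral {a..b} f" using assms(2) by (intro integral_nonneg) auto
  moreover have "integral {a..b} f \<noteq> 0"
    using integral_eq_0_iff[OF assms(1) \<open>a < b\<close>] assms(2-4) by force
  ultimately show ?thesis by linarith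
qed

section \<open>Horizontal paths from rotating profiles\<close>

text \<open>\<open>W h r\<close> is the derivative of \<open>x + r * h x\<close>.\<close>

definition W :: "(real \<Rightarrow> real) \<Rightarrow> real \<Rightarrow> real \<Rightarrow> real" where
  "W h r x = 1 + r * D h x"

text \<open>For \<open>x + r * h x\<close> with amplitude rate \<open>d\<close>, rotation speed
  \<open>w\<close> and translation rate \<open>q\<close>, the logarithmic derivative is
  \<open>(q + w) / W + d * h / W - w\<close>, because \<open>r * D h = W - 1\<close>.
  \<open>Iint\<close> and \<open>Pint\<close> integrate \<open>1 / W\<close> and
  \<open>h / W\<close>. The flux functional, which sends \<open>y\<close> to the integral of
  \<open>D y * D W / W\<close>, takes the values \<open>- Mint\<close> and \<open>Rint\<close> on
  these two fields, and 0 on constants.\<close>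

definition Iint :: "(real \<Rightarrow> real) \<Rightarrow> real \<Rightarrow> real" where
  "Iint h r = integral {0..2 * pi} (\<lambda>x. 1 / W h r x)"

definition Pint :: "(real \<Rightarrow> real) \<Rightarrow> real \<Rightarrow> real" where
  "Pint h r = integral {0..2 * pi} (\<lambda>x. h x / W h r x)"

definition Mint :: "(real \<Rightarrow> real) \<Rightarrow> real \<Rightarrow> real" where
  "Mint h r = integral {0..2 * pi} (\<lambda>x. (r * D (D h) x)\<^sup>2 / W h r x ^ 3)"

definition Rint :: "(real \<Rightarrow> real) \<Rightarrow> real \<Rightarrow> real" where
  "Rint h r = integral {0..2 * pi}
     (\<lambda>x. (D h x / W h r x - h x * (r * D (D h) x) / (W h r x)\<^sup>2) * (r * D (D h) x) / W h r x)"

text \<open>These are the displacements \<open>\<phi> x - x\<close> of the members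
  \<open>\<phi>\<close> of \<open>DiffR\<close>.\<close>

locale profile =
  fixes h :: "real \<Rightarrow> real"
  assumes smooth_h: "smooth h" and h_periodic: "h (x + 2 * pi) = h x" and D_h: "0 < 1 + D h x"
begin

lemma D_periodic: "D h (x + 2 * pi) = D h x" "D (D h) (x + 2 * pi) = D (D h) x"
proof -
  show *: "D h (x + 2 * pi) = D h x" for x
    by (rule vector_derivative_shift[OF smooth_has_vector_derivative[OF smooth_h], of _ 0]) (simp add: h_periodic)
  show "D (D h) (x + 2 * pi) = D (D h) x"
    by (rule vector_derivative_shift[OF smooth_has_vector_derivative[OF smooth_D[OF smooth_h]], of _ 0]) (simp add: *)
qed

text \<open>\<open>W h r x\<close> is a convex combination of 1 and \<open>1 + D h x\<close>. Hence
  scaling a displacement down keeps the map a diffeomorphism.\<close>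

lemma W_pos: assumes "0 \<le> r" "r \<le> 1" shows "0 < W h r x"
proof (cases "0 \<le> D h x")
  case True
  then have "0 \<le> r * D h x" using assms by simp
  then show ?thesis by (simp add: W_def)
next
  case False
  then have "1 * D h x \<le> r * D h x" using assms by (intro mult_right_mono_neg) auto
  then show ?thesis using D_h[of x] by (simp add: W_def)
qed

lemma W_nz: "0 \<le> r \<Longrightarrow> r \<le> 1 \<Longrightarrow> W h r x \<noteq> 0"
  using W_pos[of r x] by simp

lemma smooth2_h: "smooth2 r \<Longrightarrow> smooth2 (\<lambda>t x. h (r t x))" "smooth2 r \<Longrightarrow> smooth2 (\<lambda>t x. D h (r t x))"
    "smooth2 r \<Longrightarrow> smooth2 (\<lambda>t x. D (D h) (r t x))"
  by (erule smooth2_compose[OF smooth_h] smooth2_compose[OF smooth_D[OF smooth_h]]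
      smooth2_compose[OF smooth_D[OF smooth_D[OF smooth_h]]])+

lemma smooth_integrals:
  assumes "smooth \<rho>" "\<And>t. 0 \<le> \<rho> t" "\<And>t. \<rho> t \<le> 1"
  shows "smooth (\<lambda>t. Iint h (\<rho> t))" "smooth (\<lambda>t. Pint h (\<rho> t))"
    "smooth (\<lambda>t. Mint h (\<rho> t))" "smooth (\<lambda>t. Rint h (\<rho> t))"
proof -
  have r: "smooth2 (\<lambda>t x. \<rho> t)" by (rule smooth2_of_smooth[OF assms(1)])
  have W: "smooth2 (\<lambda>t x. W h (\<rho> t) x)"
    unfolding W_def by (intro smooth2_intros smooth2_h r)
  note nz = W_nz[OF assms(2,3)]
  show "smooth (\<lambda>t. Iint h (\<rho> t))"
    unfolding Iint_def by (rule smooth_integral, intro smooth2_intros smooth2_h r W nz)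
  show "smooth (\<lambda>t. Pint h (\<rho> t))"
    unfolding Pint_def by (rule smooth_integral, intro smooth2_intros smooth2_h r W nz)
  show "smooth (\<lambda>t. Mint h (\<rho> t))"
    unfolding Mint_def by (rule smooth_integral, intro smooth2_intros smooth2_h r W power_not_zero nz)
  show "smooth (\<lambda>t. Rint h (\<rho> t))"
    unfolding Rint_def by (rule smooth_integral, intro smooth2_intros smooth2_h r W power_not_zero nz)
qed

lemma integrable_profile:
  assumes r: "0 \<le> r" "r \<le> 1" and f: "smooth2 (\<lambda>t x. f x)"
  shows "(\<lambda>x. f x / W h r x ^ n) integrable_on {0..2 * pi}"
proof -
  have W: "smooth2 (\<lambda>t x. W h r x)"
    unfolding W_def by (intro smooth2_intros smooth2_h)
  have "smooth2 (\<lambda>t x. f x / W h r x ^ n)"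
    by (intro smooth2_intros f W power_not_zero W_nz r)
  from smooth2_continuous_x[OF this] show ?thesis by (rule integrable_continuous_real)
qed

text \<open>Removes the rotation from every integrand written over a common power of
  \<open>W\<close>; the free numerator \<open>G\<close> lets one statement serve all rates.\<close>

lemma integral_profile_shift:
  assumes r: "0 \<le> r" "r \<le> 1" and G: "smooth2 (\<lambda>t x. G (h x) (D h x) (D (D h) x))"
  shows "integral {0..2 * pi} (\<lambda>x. G (h (x - s)) (D h (x - s)) (D (D h) (x - s)) / W h r (x - s) ^ n) =
     integral {0..2 * pi} (\<lambda>x. G (h x) (D h x) (D (D h) x) / W h r x ^ n)"
proof -
  define f where "f = (\<lambda>x. G (h x) (D h x) (D (D h) x) / W h r x ^ n)"
  have W: "smooth2 (\<lambda>t x. W h r x)"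
    unfolding W_def by (intro smooth2_intros smooth2_h)
  have "smooth f"
    unfolding smooth_iff_smooth2 f_def by (intro smooth2_intros G W power_not_zero W_nz r)
  moreover have "f (x + 2 * pi) = f x" for x by (simp add: f_def h_periodic D_periodic W_def)
  ultimately have "integral {0..2 * pi} (\<lambda>x. f (x - s)) = integral {0..2 * pi} f"
    by (rule integral_period_shift) simp
  then show ?thesis by (simp add: f_def)
qed

text \<open>Expand \<open>1 / (1 + u) = 1 - u + u^2 / (1 + u)\<close> at
  \<open>u = r * D h x\<close>, whose mean is zero. The nonnegative remainder measures the excess
  over \<open>2 * pi\<close>, which decides the sign of \<open>kap\<close>.\<close>

lemma Iint_eq:
  assumes r: "0 \<le> r" "r \<le> 1"
  shows "Iint h r = 2 * pi + integral {0..2 * pi} (\<lambda>x. (r * D h x)\<^sup>2 / W h r x)"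
proof -
  have "integral {0..2 * pi} (D h) = h (2 * pi) - h 0"
    using fundamental_theorem_of_calculus[of 0 "2 * pi" h "D h"]
      has_vector_derivative_at_within[OF smooth_has_vector_derivative[OF smooth_h]]
    by (simp add: integral_unique)
  then have 0: "integral {0..2 * pi} (D h) = 0" using h_periodic[of 0] by simp
  have int: "(D h) integrable_on {0..2 * pi}"
    by (intro integrable_continuous_real continuous_on_subset[OF smooth_continuous[OF smooth_D[OF smooth_h]]]) simp
  have "1 / W h r x = 1 - r * D h x + (r * D h x)\<^sup>2 / W h r x" for x
    using W_nz[OF r, of x] by (simp add: W_def field_simps power2_eq_square)
  then have "Iint h r = integral {0..2 * pi} (\<lambda>x. 1 - r * D h x + (r * D h x)\<^sup>2 / W h r x)"
    by (simp add: Iint_def)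
  also have "\<dots> = 2 * pi - r * 0 + integral {0..2 * pi} (\<lambda>x. (r * D h x)\<^sup>2 / W h r x)"
  proof -
    have *: "(\<lambda>x. r * D h x) integrable_on {0..2 * pi}" by (rule integrable_on_mult_right[OF int])
    then have "(\<lambda>x. 1 - r * D h x) integrable_on {0..2 * pi}" by (intro integrable_diff) auto
    moreover have "integral {0..2 * pi} (\<lambda>x. 1 - r * D h x) = 2 * pi - r * 0"
      using * by (subst integral_diff) (auto simp: 0)
    moreover have "(\<lambda>x. (r * D h x)\<^sup>2 / W h r x) integrable_on {0..2 * pi}"
      by (rule integrable_profile[OF r, of _ 1, unfolded power_one_right]) (intro smooth2_intros smooth2_h)
    ultimately show ?thesis by (simp add: integral_add)
  qed
  finally show ?thesis by simp
qed

lemma Iint_ge: assumes "0 \<le> r" "r \<le> 1" shows "2 * pi \<le> Iint h r"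
proof -
  have "0 \<le> integral {0..2 * pi} (\<lambda>x. (r * D h x)\<^sup>2 / W h r x)"
  proof (rule integral_nonneg)
    show "(\<lambda>x. (r * D h x)\<^sup>2 / W h r x) integrable_on {0..2 * pi}"
      by (rule integrable_profile[OF assms, of _ 1, unfolded power_one_right]) (intro smooth2_intros smooth2_h)
  qed (intro divide_nonneg_pos W_pos assms zero_le_power2)
  then show ?thesis by (simp add: Iint_eq[OF assms])
qed

lemma Iint_pos: assumes "0 \<le> r" "r \<le> 1" shows "0 < Iint h r"
  using Iint_ge[OF assms] pi_gt_zero by linarith

lemma Iint_gt:
  assumes r: "0 < r" "r \<le> 1" and x: "x \<in> {0..2 * pi}" "D h x \<noteq> 0" shows "2 * pi < Iint h r"
proof -
  have W: "smooth2 (\<lambda>t x. W h r x)"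
    unfolding W_def by (intro smooth2_intros smooth2_h)
  have "smooth2 (\<lambda>t x. (r * D h x)\<^sup>2 / W h r x)"
    using r by (intro smooth2_intros smooth2_h W W_nz; simp)
  then have "0 < integral {0..2 * pi} (\<lambda>x. (r * D h x)\<^sup>2 / W h r x)"
    using r x W_pos[of r] by (intro integral_continuous_pos[of _ _ _ x] smooth2_continuous_x) (auto simp: less_imp_le)
  then show ?thesis using Iint_eq[of r] r by simp
qed

lemma Mint_nonneg: assumes "0 \<le> r" "r \<le> 1" shows "0 \<le> Mint h r"
  unfolding Mint_def
proof (rule integral_nonneg)
  show "(\<lambda>x. (r * D (D h) x)\<^sup>2 / W h r x ^ 3) integrable_on {0..2 * pi}"
    by (rule integrable_profile[OF assms]) (intro smooth2_intros smooth2_h)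
qed (intro divide_nonneg_pos zero_less_power W_pos assms zero_le_power2)

lemma Mint_pos:
  assumes r: "0 < r" "r \<le> 1" and x: "x \<in> {0..2 * pi}" "D (D h) x \<noteq> 0" shows "0 < Mint h r"
proof -
  have W: "smooth2 (\<lambda>t x. W h r x)"
    unfolding W_def by (intro smooth2_intros smooth2_h)
  have "smooth2 (\<lambda>t x. (r * D (D h) x)\<^sup>2 / W h r x ^ 3)"
    using r by (intro smooth2_intros smooth2_h W power_not_zero W_nz; simp)
  then show ?thesis unfolding Mint_def
    using r x W_pos[of r] by (intro integral_continuous_pos[of _ _ _ x] smooth2_continuous_x) (auto simp: less_imp_le)
qed

lemma integrals_0: "Iint h 0 = 2 * pi" "Mint h 0 = 0"
  by (simp_all add: Iint_def Mint_def W_def)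

end

section \<open>Superposition of four profiles that are active one after another\<close>

locale profiles =
  fixes h :: "nat \<Rightarrow> real \<Rightarrow> real"
  assumes profile_h: "profile (h i)"
begin

text \<open>The centres are 0, 1/3, 2/3 and 1 for the four indices in use, so time 0 sees only the
  first profile and time 1 only the last, both at full amplitude.\<close>

definition \<rho> :: "nat \<Rightarrow> real \<Rightarrow> real" where
  "\<rho> i t = bump (t - real i / 3)"

definition Dr :: "nat \<Rightarrow> real \<Rightarrow> real" where
  "Dr i t = D bump (t - real i / 3)"

lemma smooth2_\<rho>: "smooth2 (\<lambda>t x. \<rho> i t)" "smooth2 (\<lambda>t x. Dr i t)"
  unfolding \<rho>_def Dr_def by (intro smooth2_compose[OF smooth_bump] smooth2_compose[OF smooth_D[OF smooth_bump]] smooth2_intros)+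

lemma smooth_\<rho>: "smooth (\<rho> i)" "smooth (Dr i)"
  using smooth2_slice_t[OF smooth2_\<rho>(1)] smooth2_slice_t[OF smooth2_\<rho>(2)] by auto

lemma \<rho>_bounds: "0 \<le> \<rho> i t" "\<rho> i t \<le> 1"
  unfolding \<rho>_def by (rule bump_nonneg bump_le_1)+

lemma \<rho>_has_derivative: "(\<rho> i has_real_derivative Dr i t) (at t)"
proof -
  have "((\<lambda>t. bump (t - real i / 3)) has_real_derivative D bump (t - real i / 3) * 1) (at t)"
    by (rule DERIV_chain2[OF smooth_has_real_derivative[OF smooth_bump]]) (auto intro!: derivative_eq_intros)
  then show ?thesis unfolding \<rho>_def Dr_def by simp
qed

lemma active_index:
  obtains i where "i < 4" "\<And>j. j < 4 \<Longrightarrow> j \<noteq> i \<Longrightarrow> \<rho> j t = 0 \<and> Dr j t = 0"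
proof -
  have *: "\<rho> j t = 0 \<and> Dr j t = 0" if "1 / 6 \<le> \<bar>t - real j / 3\<bar>" for j
    using that unfolding \<rho>_def Dr_def by (simp add: bump_eq_0 D_bump_eq_0)
  consider "\<forall>j<4. 1 / 6 \<le> \<bar>t - real j / 3\<bar>" | i where "i < 4" "\<bar>t - real i / 3\<bar> < 1 / 6" by force
  then show ?thesis
  proof cases
    case 1
    \<comment> \<open>If all four vanish, any index satisfies the claim.\<close>
    then show ?thesis using * that[of 0] by simp
  next
    case 2
    have "1 / 6 \<le> \<bar>t - real j / 3\<bar>" if "j \<noteq> i" for j
    proof -
      have "1 \<le> \<bar>real j - real i\<bar>" using that by linarith
      then show ?thesis using 2(2) by argo
    qed
    then show ?thesis using * that[of i] 2(1) by blast
  qed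
qed

definition v :: "(nat \<Rightarrow> real) \<Rightarrow> real \<Rightarrow> real \<Rightarrow> real" where
  "v w t x = (\<Sum>i<4. \<rho> i t * h i (x - w i * t))"

definition vt :: "(nat \<Rightarrow> real) \<Rightarrow> real \<Rightarrow> real \<Rightarrow> real" where
  "vt w t x = (\<Sum>i<4. Dr i t * h i (x - w i * t) - w i * \<rho> i t * D (h i) (x - w i * t))"

definition vtx :: "(nat \<Rightarrow> real) \<Rightarrow> real \<Rightarrow> real \<Rightarrow> real" where
  "vtx w t x = (\<Sum>i<4. Dr i t * D (h i) (x - w i * t) - w i * \<rho> i t * D (D (h i)) (x - w i * t))"

definition V :: "(nat \<Rightarrow> real) \<Rightarrow> real \<Rightarrow> real \<Rightarrow> real" where
  "V w t x = 1 + (\<Sum>i<4. \<rho> i t * D (h i) (x - w i * t))"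

definition Vx :: "(nat \<Rightarrow> real) \<Rightarrow> real \<Rightarrow> real \<Rightarrow> real" where
  "Vx w t x = (\<Sum>i<4. \<rho> i t * D (D (h i)) (x - w i * t))"

lemma smooth2_v: "smooth2 (v w)" "smooth2 (vt w)" "smooth2 (vtx w)" "smooth2 (V w)" "smooth2 (Vx w)"
  unfolding v_def vt_def vtx_def V_def Vx_def
  by (intro smooth2_intros smooth2_\<rho> profile.smooth2_h[OF profile_h])+

lemma h_shift_derivatives:
  "((\<lambda>t. h i (x - w i * t)) has_real_derivative - w i * D (h i) (x - w i * t)) (at t)"
  "((\<lambda>x. h i (x - w i * t)) has_real_derivative D (h i) (x - w i * t)) (at x)"
  "((\<lambda>x. D (h i) (x - w i * t)) has_real_derivative D (D (h i)) (x - w i * t)) (at x)"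
proof -
  have h: "(h i has_real_derivative D (h i) y) (at y)" "(D (h i) has_real_derivative D (D (h i)) y) (at y)" for y
    using smooth_has_real_derivative smooth_D profile.smooth_h[OF profile_h] by blast+
  have "((\<lambda>t. h i (x - w i * t)) has_real_derivative D (h i) (x - w i * t) * (- w i)) (at t)"
    by (rule DERIV_chain2[OF h(1)]) (auto intro!: derivative_eq_intros)
  then show "((\<lambda>t. h i (x - w i * t)) has_real_derivative - w i * D (h i) (x - w i * t)) (at t)"
    by (simp add: mult.commute)
  have "((\<lambda>x. h i (x - w i * t)) has_real_derivative D (h i) (x - w i * t) * 1) (at x)"
    by (rule DERIV_chain2[OF h(1)]) (auto intro!: derivative_eq_intros)
  then show "((\<lambda>x. h i (x - w i * t)) has_real_derivative D (h i) (x - w i * t)) (at x)" by simp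
  have "((\<lambda>x. D (h i) (x - w i * t)) has_real_derivative D (D (h i)) (x - w i * t) * 1) (at x)"
    by (rule DERIV_chain2[OF h(2)]) (auto intro!: derivative_eq_intros)
  then show "((\<lambda>x. D (h i) (x - w i * t)) has_real_derivative D (D (h i)) (x - w i * t)) (at x)" by simp
qed

lemma v_derivatives:
  "((\<lambda>t. v w t x) has_real_derivative vt w t x) (at t)"
  "((\<lambda>x. v w t x) has_real_derivative V w t x - 1) (at x)"
  "((\<lambda>x. V w t x) has_real_derivative Vx w t x) (at x)"
  "((\<lambda>x. vt w t x) has_real_derivative vtx w t x) (at x)"
proof -
  have "((\<lambda>t. v w t x) has_real_derivative
      (\<Sum>i<4. Dr i t * h i (x - w i * t) + (- w i * D (h i) (x - w i * t)) * \<rho> i t)) (at t)"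
    unfolding v_def by (intro DERIV_sum DERIV_mult \<rho>_has_derivative h_shift_derivatives)
  then show "((\<lambda>t. v w t x) has_real_derivative vt w t x) (at t)"
    by (simp add: vt_def mult_ac)
  have "((\<lambda>x. v w t x) has_real_derivative (\<Sum>i<4. \<rho> i t * D (h i) (x - w i * t))) (at x)"
    unfolding v_def by (intro DERIV_sum DERIV_cmult h_shift_derivatives)
  then show "((\<lambda>x. v w t x) has_real_derivative V w t x - 1) (at x)"
    by (simp add: V_def)
  have "((\<lambda>x. V w t x) has_real_derivative 0 + (\<Sum>i<4. \<rho> i t * D (D (h i)) (x - w i * t))) (at x)"
    unfolding V_def by (intro DERIV_add DERIV_const DERIV_sum DERIV_cmult h_shift_derivatives)
  then show "((\<lambda>x. V w t x) has_real_derivative Vx w t x) (at x)"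
    by (simp add: Vx_def)
  show "((\<lambda>x. vt w t x) has_real_derivative vtx w t x) (at x)"
    unfolding vt_def vtx_def by (intro DERIV_sum DERIV_diff DERIV_cmult h_shift_derivatives)
qed

lemma active_formulas:
  assumes "i < 4" "\<And>j. j < 4 \<Longrightarrow> j \<noteq> i \<Longrightarrow> \<rho> j t = 0 \<and> Dr j t = 0"
  shows "vt w t x = Dr i t * h i (x - w i * t) - w i * \<rho> i t * D (h i) (x - w i * t)"
    "vtx w t x = Dr i t * D (h i) (x - w i * t) - w i * \<rho> i t * D (D (h i)) (x - w i * t)"
    "V w t x = W (h i) (\<rho> i t) (x - w i * t)" "Vx w t x = \<rho> i t * D (D (h i)) (x - w i * t)"
proof -
  have *: "(\<Sum>j<4. f j) = f i" if "\<And>j. j < 4 \<Longrightarrow> j \<noteq> i \<Longrightarrow> f j = 0" for f :: "nat \<Rightarrow> real"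
    using sum.remove[of "{..<4}" i f] assms(1) that by simp
  show "vt w t x = Dr i t * h i (x - w i * t) - w i * \<rho> i t * D (h i) (x - w i * t)"
    "vtx w t x = Dr i t * D (h i) (x - w i * t) - w i * \<rho> i t * D (D (h i)) (x - w i * t)"
    "V w t x = W (h i) (\<rho> i t) (x - w i * t)" "Vx w t x = \<rho> i t * D (D (h i)) (x - w i * t)"
    unfolding vt_def vtx_def V_def Vx_def W_def by (subst *; simp add: assms(2))+
qed

lemma V_pos: "0 < V w t x"
proof -
  obtain i where "i < 4" "\<And>j. j < 4 \<Longrightarrow> j \<noteq> i \<Longrightarrow> \<rho> j t = 0 \<and> Dr j t = 0" by (rule active_index[of t]) blast
  from active_formulas(3)[OF this] show ?thesis
    by (simp add: profile.W_pos[OF profile_h] \<rho>_bounds)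
qed

lemma V_nz: "V w t x \<noteq> 0"
  using V_pos[of w t x] by simp

text \<open>The unique translation rate for which \<open>(q w t + vt w t x) / V w t x\<close> has
  zero mean.\<close>

definition q :: "(nat \<Rightarrow> real) \<Rightarrow> real \<Rightarrow> real" where
  "q w t = - integral {0..2 * pi} (\<lambda>x. vt w t x / V w t x) / integral {0..2 * pi} (\<lambda>x. 1 / V w t x)"

text \<open>The space derivative of the logarithmic derivative
  \<open>(q w t + vt w t x) / V w t x\<close>; the function \<open>\<beta>\<close> below is then the
  flux.\<close>

definition Xx :: "(nat \<Rightarrow> real) \<Rightarrow> real \<Rightarrow> real \<Rightarrow> real" where
  "Xx w t x = vtx w t x / V w t x - (q w t + vt w t x) * Vx w t x / (V w t x)\<^sup>2"

definition \<beta> :: "(nat \<Rightarrow> real) \<Rightarrow> real \<Rightarrow> real" where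
  "\<beta> w t = integral {0..2 * pi} (\<lambda>x. Xx w t x * Vx w t x / V w t x)"

text \<open>\<open>kap i\<close> and \<open>lam i\<close> are the coefficients of the rotation speed \<open>w i\<close> in the rates \<open>q w\<close> and
  \<open>\<beta> w\<close>; the parts \<open>kap0 i\<close> and \<open>lam0 i\<close> do not depend on the speeds.\<close>

definition kap :: "nat \<Rightarrow> real \<Rightarrow> real" where
  "kap i t = 2 * pi / Iint (h i) (\<rho> i t) - 1"

definition lam :: "nat \<Rightarrow> real \<Rightarrow> real" where
  "lam i t = - 2 * pi * Mint (h i) (\<rho> i t) / Iint (h i) (\<rho> i t)"

definition kap0 :: "nat \<Rightarrow> real \<Rightarrow> real" where
  "kap0 i t = - Dr i t * Pint (h i) (\<rho> i t) / Iint (h i) (\<rho> i t)"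

definition lam0 :: "nat \<Rightarrow> real \<Rightarrow> real" where
  "lam0 i t = Dr i t * Rint (h i) (\<rho> i t) +
     Dr i t * Pint (h i) (\<rho> i t) * Mint (h i) (\<rho> i t) / Iint (h i) (\<rho> i t)"

lemma Iint_\<rho>_pos: "0 < Iint (h i) (\<rho> i t)"
  by (rule profile.Iint_pos[OF profile_h \<rho>_bounds])

text \<open>At every time only one bump is active, and the integrals over a period do not see the rotation
  by \<open>w i * t\<close>.\<close>

lemma rates:
  shows q_eq: "q w t = (\<Sum>i<4. kap0 i t) + (\<Sum>i<4. w i * kap i t)"
    and \<beta>_eq: "\<beta> w t = (\<Sum>i<4. lam0 i t) + (\<Sum>i<4. w i * lam i t)"
    and integral_inverse_V_pos: "0 < integral {0..2 * pi} (\<lambda>x. 1 / V w t x)"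
proof -
  obtain i where i: "i < 4" "\<And>j. j < 4 \<Longrightarrow> j \<noteq> i \<Longrightarrow> \<rho> j t = 0 \<and> Dr j t = 0" by (rule active_index[of t]) blast
  interpret profile "h i" by (rule profile_h)
  define r d s H where "r = \<rho> i t" and "d = Dr i t" and "s = w i * t" and "H = h i"
  have act: "vt w t x = d * H (x - s) - w i * r * D H (x - s)"
    "vtx w t x = d * D H (x - s) - w i * r * D (D H) (x - s)"
    "V w t x = W H r (x - s)" "Vx w t x = r * D (D H) (x - s)" for x
    unfolding r_def d_def s_def H_def by (rule active_formulas; use i in blast)+
  have r: "0 \<le> r" "r \<le> 1" unfolding r_def by (rule \<rho>_bounds)+
  have only_i: "(\<Sum>j<4. f j) = f i" if "\<And>j. j < 4 \<Longrightarrow> j \<noteq> i \<Longrightarrow> f j = 0" for f :: "nat \<Rightarrow> real"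
    using sum.remove[of "{..<4}" i f] i(1) that by simp
  note nz = W_nz[OF r, folded H_def]
  note sm = smooth2_h[OF smooth2_snd, folded H_def]
  note int = integrable_profile[OF r, folded H_def]
  note shift = integral_profile_shift[OF r, folded H_def, where s = s]
  have I: "integral {0..2 * pi} (\<lambda>x. 1 / V w t x) = Iint H r"
    unfolding act Iint_def
    using shift[of "\<lambda>_ _ _. 1" 1] by (simp add: smooth2_const)
  have I_pos: "0 < Iint H r" using Iint_pos[OF r] by (simp add: H_def)
  show "0 < integral {0..2 * pi} (\<lambda>x. 1 / V w t x)" unfolding I by (rule I_pos)
  have P: "integral {0..2 * pi} (\<lambda>x. vt w t x / V w t x) = d * Pint H r - w i * (2 * pi - Iint H r)"
  proof -
    have "integral {0..2 * pi} (\<lambda>x. vt w t x / V w t x) =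
        integral {0..2 * pi} (\<lambda>x. (d * H (x - s) - w i * r * D H (x - s)) / W H r (x - s))"
      unfolding act by simp
    also have "\<dots> = integral {0..2 * pi} (\<lambda>x. (d * H x - w i * r * D H x) / W H r x)"
      using shift[of "\<lambda>a b _. d * a - w i * r * b" 1] by (simp add: smooth2_intros sm)
    \<comment> \<open>Replacing \<open>r * D H x\<close> by \<open>W H r x - 1\<close> reduces the
      rotation term to \<open>Iint\<close>.\<close>
    also have "\<dots> = integral {0..2 * pi} (\<lambda>x. d * (H x / W H r x) - w i * (1 - 1 / W H r x))"
    proof (rule integral_cong)
      fix x
      define y where "y = W H r x"
      have "y \<noteq> 0" "w i * r * D H x = w i * (y - 1)" using nz by (auto simp: y_def W_def)
      then show "(d * H x - w i * r * D H x) / W H r x = d * (H x / W H r x) - w i * (1 - 1 / W H r x)"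
        unfolding y_def[symmetric] by (simp add: field_simps)
    qed
    also have "\<dots> = d * Pint H r - w i * (2 * pi - Iint H r)"
    proof (intro integral_unique has_integral_diff has_integral_mult_right)
      have "(\<lambda>x. 1 / W H r x) integrable_on {0..2 * pi}" "(\<lambda>x. H x / W H r x) integrable_on {0..2 * pi}"
        using int[of "\<lambda>_. 1" 1] int[of H 1] by (simp_all add: smooth2_const sm)
      then show "((\<lambda>x. 1 / W H r x) has_integral Iint H r) {0..2 * pi}"
        "((\<lambda>x. H x / W H r x) has_integral Pint H r) {0..2 * pi}"
        unfolding Iint_def Pint_def by (simp_all add: integrable_integral)
      show "((\<lambda>x. 1) has_integral 2 * pi) {0..2 * pi}"
        using has_integral_const_real[of "1::real" 0 "2 * pi"] by simp
    qed
    finally show ?thesis .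
  qed
  have q: "q w t = - d * Pint H r / Iint H r + w i * (2 * pi / Iint H r - 1)"
    unfolding q_def I P using I_pos by (simp add: field_simps)
  \<comment> \<open>Inactive indices contribute nothing: \<open>Iint\<close> at amplitude 0 is
    \<open>2 * pi\<close>, which kills \<open>kap\<close>, and \<open>kap0\<close> carries the
    factor \<open>Dr\<close>.\<close>
  show "q w t = (\<Sum>i<4. kap0 i t) + (\<Sum>i<4. w i * kap i t)"
    unfolding q by (subst (1 2) only_i)
      (use i(2) profile.integrals_0[OF profile_h] in \<open>auto simp: kap_def kap0_def r_def d_def H_def\<close>)
  \<comment> \<open>The constant part \<open>- w i\<close> of the field has no space derivative, so
    translation and rotation enter only through \<open>q w t + w i\<close>.\<close>
  have "\<beta> w t = integral {0..2 * pi} (\<lambda>x. d * ((D H x / W H r x - H x * (r * D (D H) x) / (W H r x)\<^sup>2) * (r * D (D H) x) / W H r x)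
      - (q w t + w i) * ((r * D (D H) x)\<^sup>2 / W H r x ^ 3))"
  proof -
    \<comment> \<open>The numerator over the common denominator \<open>W H r x ^ 3\<close>, in the
      form to which the rotation lemma applies.\<close>
    let ?G = "\<lambda>a b c. ((d * b - w i * r * c) * (1 + r * b) - (q w t + (d * a - w i * r * b)) * (r * c)) * (r * c)"
    have "\<beta> w t = integral {0..2 * pi} (\<lambda>x. ?G (H (x - s)) (D H (x - s)) (D (D H) (x - s)) / W H r (x - s) ^ 3)"
      unfolding \<beta>_def Xx_def act
      using nz by (intro integral_cong) (simp add: W_def[symmetric] field_simps power2_eq_square power3_eq_cube)
    also have "\<dots> = integral {0..2 * pi} (\<lambda>x. ?G (H x) (D H x) (D (D H) x) / W H r x ^ 3)"
      by (rule shift) (intro smooth2_intros sm)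
    also have "\<dots> = integral {0..2 * pi} (\<lambda>x. d * ((D H x / W H r x - H x * (r * D (D H) x) / (W H r x)\<^sup>2) * (r * D (D H) x) / W H r x)
      - (q w t + w i) * ((r * D (D H) x)\<^sup>2 / W H r x ^ 3))"
    proof (rule integral_cong)
      fix x
      define a b c y where "a = H x" and "b = r * D H x" and "c = r * D (D H) x" and "y = W H r x"
      have "y \<noteq> 0" "b = y - 1" using nz by (auto simp: y_def b_def W_def)
      have "((d * D H x - w i * c) * y - (q w t + (d * a - w i * b)) * c) * c / y ^ 3 =
          d * ((D H x / y - a * c / y\<^sup>2) * c / y) - (q w t + w i) * (c\<^sup>2 / y ^ 3)"
        using \<open>y \<noteq> 0\<close> unfolding \<open>b = y - 1\<close> by (simp add: field_simps power2_eq_square power3_eq_cube)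
      then show "?G (H x) (D H x) (D (D H) x) / W H r x ^ 3 =
        d * ((D H x / W H r x - H x * (r * D (D H) x) / (W H r x)\<^sup>2) * (r * D (D H) x) / W H r x)
      - (q w t + w i) * ((r * D (D H) x)\<^sup>2 / W H r x ^ 3)"
        by (simp add: a_def b_def c_def y_def W_def mult.assoc)
    qed
    finally show ?thesis .
  qed
  also have "\<dots> = d * Rint H r - (q w t + w i) * Mint H r"
  proof -
    have "(D H x / W H r x - H x * (r * D (D H) x) / (W H r x)\<^sup>2) * (r * D (D H) x) / W H r x
        = (D H x * W H r x - H x * (r * D (D H) x)) * (r * D (D H) x) / W H r x ^ 3" for x
      using nz[of x] by (simp add: field_simps power2_eq_square power3_eq_cube)
    moreover have "(\<lambda>x. (D H x * W H r x - H x * (r * D (D H) x)) * (r * D (D H) x) / W H r x ^ 3) integrable_on {0..2 * pi}"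
      unfolding W_def[of H r, abs_def] by (rule int[unfolded W_def]) (intro smooth2_intros sm)
    moreover have "(\<lambda>x. (r * D (D H) x)\<^sup>2 / W H r x ^ 3) integrable_on {0..2 * pi}"
      by (rule int) (intro smooth2_intros sm)
    ultimately have "((\<lambda>x. (D H x / W H r x - H x * (r * D (D H) x) / (W H r x)\<^sup>2) * (r * D (D H) x) / W H r x)
        has_integral Rint H r) {0..2 * pi}"
      "((\<lambda>x. (r * D (D H) x)\<^sup>2 / W H r x ^ 3) has_integral Mint H r) {0..2 * pi}"
      unfolding Rint_def Mint_def by (simp_all add: integrable_integral)
    then show ?thesis
      by (intro integral_unique has_integral_diff has_integral_mult_right)
  qed
  finally have \<beta>: "\<beta> w t = d * Rint H r - (q w t + w i) * Mint H r" .
  \<comment> \<open>Inserting the formula for \<open>q w t\<close> gives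
    \<open>q w t + w i = (2 * pi * w i - d * Pint H r) / Iint H r\<close>, whence \<open>lam\<close>
    and \<open>lam0\<close>.\<close>
  show "\<beta> w t = (\<Sum>i<4. lam0 i t) + (\<Sum>i<4. w i * lam i t)"
    unfolding \<beta> q using I_pos by (subst (1 2) only_i)
      (use i(2) profile.integrals_0[OF profile_h] in \<open>auto simp: lam_def lam0_def r_def d_def H_def field_simps\<close>)
qed

lemma smooth_rates: "smooth (kap i)" "smooth (lam i)" "smooth (kap0 i)" "smooth (lam0 i)"
proof -
  have nz: "Iint (h i) (\<rho> i t) \<noteq> 0" for t using Iint_\<rho>_pos[of i t] by simp
  note sm = profile.smooth_integrals[OF profile_h smooth_\<rho>(1) \<rho>_bounds, THEN smooth2_of_smooth(1)]
    smooth_\<rho>(2)[THEN smooth2_of_smooth(1)]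
  show "smooth (kap i)" "smooth (lam i)" "smooth (kap0 i)" "smooth (lam0 i)"
    unfolding smooth_iff_smooth2 kap_def lam_def kap0_def lam0_def by (intro smooth2_intros sm nz)+
qed

lemma integral_rates:
  shows "integral {0..1} (q w) = (\<Sum>i<4. integral {0..1} (kap0 i)) + (\<Sum>i<4. w i * integral {0..1} (kap i))"
    and "integral {0..1} (\<beta> w) = (\<Sum>i<4. integral {0..1} (lam0 i)) + (\<Sum>i<4. w i * integral {0..1} (lam i))"
proof -
  have *: "(f has_integral integral {0..1} f) {0..1}" if "smooth f" for f :: "real \<Rightarrow> real"
    using that by (intro integrable_integral integrable_continuous_real continuous_on_subset[OF smooth_continuous]) auto
  show "integral {0..1} (q w) = (\<Sum>i<4. integral {0..1} (kap0 i)) + (\<Sum>i<4. w i * integral {0..1} (kap i))"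
    unfolding q_eq[abs_def]
    by (intro integral_unique has_integral_add has_integral_sum has_integral_mult_right * smooth_rates finite_lessThan)
  show "integral {0..1} (\<beta> w) = (\<Sum>i<4. integral {0..1} (lam0 i)) + (\<Sum>i<4. w i * integral {0..1} (lam i))"
    unfolding \<beta>_eq[abs_def]
    by (intro integral_unique has_integral_add has_integral_sum has_integral_mult_right * smooth_rates finite_lessThan)
qed

lemma smooth_q: "smooth (q w)"
proof -
  have nz: "integral {0..2 * pi} (\<lambda>x. 1 / V w t x) \<noteq> 0" for t
    using integral_inverse_V_pos[of w t] by simp
  have "smooth (\<lambda>t. integral {0..2 * pi} (\<lambda>x. vt w t x / V w t x))" "smooth (\<lambda>t. integral {0..2 * pi} (\<lambda>x. 1 / V w t x))"
    by (intro smooth_integral smooth2_intros smooth2_v V_nz)+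
  from this[THEN smooth2_of_smooth(1)] show ?thesis
    unfolding smooth_iff_smooth2 q_def by (intro smooth2_intros nz)
qed

lemma horizontal_path:
  obtains \<phi> where "smooth2 \<phi>" "\<And>t. \<phi> t \<in> carrier DiffR"
    "\<phi> 0 = (\<lambda>x. x + v w 0 x)" "\<phi> 1 = (\<lambda>x. x + integral {0..1} (q w) + v w 1 x)"
    "\<And>t. integral {0..2 * pi} (\<lambda>x. Dt \<phi> t x / Dx \<phi> t x) = 0"
    "\<And>t. integral {0..2 * pi} (\<lambda>x. Dx (\<lambda>t x. Dt \<phi> t x / Dx \<phi> t x) t x * Dx (Dx \<phi>) t x / Dx \<phi> t x) = \<beta> w t"
proof -
  \<comment> \<open>Starting the translation at 0 leaves the initial point fixed and shifts the
    final one by the integral of \<open>q w\<close>.\<close>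
  obtain c where c: "smooth c" "\<And>t. (c has_vector_derivative q w t) (at t)" "c 0 = 0"
    using smooth_has_antiderivative[OF smooth_q[of w], of 0 0] by blast
  have c1: "integral {0..1} (q w) = c 1"
    using fundamental_theorem_of_calculus[of 0 1 c "q w"] has_vector_derivative_at_within[OF c(2)] c(3)
    by (simp add: integral_unique)
  define \<phi> where "\<phi> t x = x + c t + v w t x" for t x
  have sm: "smooth2 \<phi>"
    unfolding \<phi>_def[abs_def] by (intro smooth2_intros smooth2_v smooth2_of_smooth(2)[OF c(1)])
  have dt: "Dt \<phi> = (\<lambda>t x. q w t + vt w t x)"
  proof (rule Dt_eqI)
    have "((\<lambda>s. x + c s + v w s x) has_real_derivative 0 + q w t + vt w t x) (at t)" for t x
      by (intro DERIV_add DERIV_const v_derivatives c(2)[folded has_real_derivative_iff_has_vector_derivative])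
    then show "((\<lambda>s. \<phi> s x) has_vector_derivative q w t + vt w t x) (at t)" for t x
      by (simp add: \<phi>_def has_real_derivative_iff_has_vector_derivative)
  qed
  have dx: "Dx \<phi> = V w"
  proof (rule Dx_eqI)
    have "((\<lambda>x. x + c t + v w t x) has_real_derivative 1 + 0 + (V w t x - 1)) (at x)" for t x
      by (intro DERIV_add DERIV_const DERIV_ident v_derivatives)
    then show "(\<phi> t has_vector_derivative V w t x) (at x)" for t x
      by (simp add: \<phi>_def[abs_def] has_real_derivative_iff_has_vector_derivative)
  qed
  have dxx: "Dx (V w) = Vx w"
    by (rule Dx_eqI) (use v_derivatives(3) in \<open>simp add: has_real_derivative_iff_has_vector_derivative\<close>)
  have dX: "Dx (\<lambda>t x. (q w t + vt w t x) / V w t x) = Xx w"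
  proof (rule Dx_eqI)
    have "((\<lambda>x. (q w t + vt w t x) / V w t x) has_real_derivative
        ((0 + vtx w t x) * V w t x - (q w t + vt w t x) * Vx w t x) / (V w t x * V w t x)) (at x)" for t x
      by (intro DERIV_divide DERIV_add DERIV_const v_derivatives V_nz)
    moreover have "((0 + vtx w t x) * V w t x - (q w t + vt w t x) * Vx w t x) / (V w t x * V w t x) = Xx w t x" for t x
      using V_nz[of w t x] by (simp add: Xx_def diff_divide_distrib power2_eq_square)
    ultimately show "((\<lambda>x. (q w t + vt w t x) / V w t x) has_vector_derivative Xx w t x) (at x)" for t x
      by (simp add: has_real_derivative_iff_has_vector_derivative)
  qed
  show ?thesis
  proof (rule that)
    show "smooth2 \<phi>" by (rule sm)
    show "\<phi> t \<in> carrier DiffR" for t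
    proof (rule DiffR_I)
      show "smooth (\<phi> t)" by (rule smooth2_slice_x[OF sm])
      show "0 < D (\<phi> t) x" for x using dx V_pos by (metis Dx_def)
      show "\<phi> t (x + 2 * pi) = \<phi> t x + 2 * pi" for x
        using profile.h_periodic[OF profile_h, of _ "x - w _ * t"] by (simp add: \<phi>_def v_def algebra_simps)
    qed
    show "\<phi> 0 = (\<lambda>x. x + v w 0 x)" "\<phi> 1 = (\<lambda>x. x + integral {0..1} (q w) + v w 1 x)"
      by (auto simp: \<phi>_def c1 c(3))
    show "integral {0..2 * pi} (\<lambda>x. Dt \<phi> t x / Dx \<phi> t x) = 0" for t
    proof -
      have "(\<lambda>x. 1 / V w t x) integrable_on {0..2 * pi}" "(\<lambda>x. vt w t x / V w t x) integrable_on {0..2 * pi}"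
        by (intro integrable_continuous_real smooth2_continuous_x[of "\<lambda>t x. 1 / V w t x"]
            smooth2_continuous_x[of "\<lambda>t x. vt w t x / V w t x"] smooth2_intros smooth2_v V_nz)+
      note has_integral_add[OF has_integral_mult_right[OF integrable_integral[OF this(1)], of "q w t"]
          integrable_integral[OF this(2)]]
      moreover have "q w t * integral {0..2 * pi} (\<lambda>x. 1 / V w t x) + integral {0..2 * pi} (\<lambda>x. vt w t x / V w t x) = 0"
        using integral_inverse_V_pos[of w t] by (simp add: q_def)
      ultimately show ?thesis unfolding dt dx by (simp add: add_divide_distrib integral_unique)
    qed
    show "integral {0..2 * pi} (\<lambda>x. Dx (\<lambda>t x. Dt \<phi> t x / Dx \<phi> t x) t x * Dx (Dx \<phi>) t x / Dx \<phi> t x) = \<beta> w t" for t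
      unfolding dt dx dX dxx \<beta>_def ..
  qed
qed

end

section \<open>Paths between given diffeomorphisms with prescribed flux\<close>

lemma smooth_sin: "smooth (sin :: real \<Rightarrow> real)"
proof -
  have "((\<lambda>x. sin (x + real k * (pi / 2))) has_vector_derivative sin (x + real (Suc k) * (pi / 2))) (at x)" for k x
  proof -
    have "((\<lambda>x. sin (x + real k * (pi / 2))) has_real_derivative cos (x + real k * (pi / 2))) (at x)"
      by (auto intro!: derivative_eq_intros)
    moreover have "sin (x + real (Suc k) * (pi / 2)) = sin (x + real k * (pi / 2) + pi / 2)"
      by (simp add: field_simps)
    ultimately show ?thesis
      by (simp add: sin_add flip: has_real_derivative_iff_has_vector_derivative)
  qed
  from smooth_sequenceI[of "\<lambda>k x. sin (x + real k * (pi / 2))", OF this] show ?thesis by simp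
qed

definition wave1 :: "real \<Rightarrow> real" where "wave1 x = sin x / 2"
text \<open>The amplitude is chosen so that \<open>wave2 x = wave1 (2 * x) / 2\<close>; both first
  derivatives then have the same range, bounded by 1/2.\<close>

definition wave2 :: "real \<Rightarrow> real" where "wave2 x = sin (2 * x) / 4"

lemma smooth_wave: "smooth wave1" "smooth wave2"
  unfolding smooth_iff_smooth2 wave1_def wave2_def
  by (intro smooth2_intros smooth2_compose[OF smooth_sin]; simp)+

lemma D_wave:
  "D wave1 = (\<lambda>x. cos x / 2)" "D (D wave1) = (\<lambda>x. - sin x / 2)"
  "D wave2 = (\<lambda>x. cos (2 * x) / 2)" "D (D wave2) = (\<lambda>x. - sin (2 * x))"
proof -
  show 1: "D wave1 = (\<lambda>x. cos x / 2)"
    by (rule D_eqI)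
      (auto simp: wave1_def[abs_def] simp flip: has_real_derivative_iff_has_vector_derivative intro!: derivative_eq_intros)
  show "D (D wave1) = (\<lambda>x. - sin x / 2)"
    unfolding 1 by (rule D_eqI)
      (auto simp flip: has_real_derivative_iff_has_vector_derivative intro!: derivative_eq_intros)
  show 2: "D wave2 = (\<lambda>x. cos (2 * x) / 2)"
    by (rule D_eqI)
      (auto simp: wave2_def[abs_def] simp flip: has_real_derivative_iff_has_vector_derivative intro!: derivative_eq_intros)
  show "D (D wave2) = (\<lambda>x. - sin (2 * x))"
    unfolding 2 by (rule D_eqI)
      (auto simp flip: has_real_derivative_iff_has_vector_derivative intro!: derivative_eq_intros)
qed

lemma half_cos_bound: "0 < 1 + cos x / (2::real)"
  using cos_ge_minus_one[of x] by linarith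

lemma profile_wave: "profile wave1" "profile wave2"
proof -
  show "profile wave1"
    by unfold_locales (auto simp: smooth_wave D_wave half_cos_bound wave1_def)
  have "sin (2 * (x + 2 * pi)) = sin (2 * x)" for x :: real
    using sin_periodic[of "2 * x + 2 * pi"] sin_periodic[of "2 * x"] by (simp add: algebra_simps)
  then show "profile wave2"
    by unfold_locales (auto simp: smooth_wave D_wave half_cos_bound wave2_def)
qed

text \<open>First derivatives agree after doubling the argument, whereas the second derivative gains
  a factor 2, which is squared in \<open>Mint\<close>. This makes the two linear conditions on the
  speeds independent.\<close>

lemma wave_scaling:
  assumes "0 \<le> r" "r \<le> 1"
  shows "Iint wave2 r = Iint wave1 r" "Mint wave2 r = 4 * Mint wave1 r"
proof -
  have W: "W wave2 r x = W wave1 r (2 * x)" for x by (simp add: W_def D_wave)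
  have sm: "smooth2 (\<lambda>t x. W wave1 r x)" "smooth2 (\<lambda>t x. D (D wave1) x)"
    unfolding W_def by (intro smooth2_intros profile.smooth2_h[OF profile_wave(1)])+
  have per: "W wave1 r (x + 2 * pi) = W wave1 r x" "D (D wave1) (x + 2 * pi) = D (D wave1) x" for x
    by (simp_all add: W_def profile.D_periodic[OF profile_wave(1)])
  note nz = profile.W_nz[OF profile_wave(1) assms]
  have "smooth (\<lambda>x. 1 / W wave1 r x)"
    unfolding smooth_iff_smooth2 by (intro smooth2_intros sm nz)
  from integral_double_period[OF this, of "2 * pi"]
  show "Iint wave2 r = Iint wave1 r" unfolding Iint_def W by (simp add: per)
  have "smooth (\<lambda>x. (r * D (D wave1) x)\<^sup>2 / W wave1 r x ^ 3)"
    unfolding smooth_iff_smooth2 by (intro smooth2_intros sm nz power_not_zero)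
  from integral_double_period[OF this, of "2 * pi"]
  have *: "integral {0..2 * pi} (\<lambda>x. (r * D (D wave1) (2 * x))\<^sup>2 / W wave1 r (2 * x) ^ 3) = Mint wave1 r"
    unfolding Mint_def by (simp add: per)
  have "Mint wave2 r = integral {0..2 * pi} (\<lambda>x. 4 * ((r * D (D wave1) (2 * x))\<^sup>2 / W wave1 r (2 * x) ^ 3))"
    unfolding Mint_def W by (intro integral_cong) (simp add: D_wave(2,4) power_mult_distrib power2_eq_square)
  then show "Mint wave2 r = 4 * Mint wave1 r" by (simp only: integral_mult_right *)
qed

text \<open>Both translates of the support lie inside \<open>{0..1}\<close>, so each integral
  captures all of \<open>g\<close>: an antiderivative is constant on \<open>{1/3..2/3}\<close> and
  on \<open>{-2/3..-1/3}\<close>.\<close>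

lemma integral_supported_shift:
  fixes g :: "real \<Rightarrow> real"
  assumes g: "smooth g" "\<And>t. 1 / 6 \<le> \<bar>t\<bar> \<Longrightarrow> g t = 0"
  shows "integral {0..1} (\<lambda>t. g (t - 2 / 3)) = integral {0..1} (\<lambda>t. g (t - 1 / 3))"
proof -
  obtain G where G: "\<And>x. (G has_real_derivative g x) (at x)"
    using smooth_has_antiderivative[OF g(1)] unfolding has_real_derivative_iff_has_vector_derivative by metis
  have ftc: "integral {a..b} (\<lambda>t. g (t - s)) = G (b - s) - G (a - s)" if "a \<le> b" for a b s
  proof -
    have "((\<lambda>x. G (x - s)) has_real_derivative g (x - s) * 1) (at x)" for x
      by (rule DERIV_chain2[OF G]) (auto intro!: derivative_eq_intros)
    then show ?thesis
      using fundamental_theorem_of_calculus[OF that, of "\<lambda>x. G (x - s)" "\<lambda>x. g (x - s)"]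
      by (auto simp: has_real_derivative_iff_has_vector_derivative has_vector_derivative_at_within
          intro!: integral_unique)
  qed
  have "integral {1/3..2/3} (\<lambda>t. g (t - 0)) = integral {1/3..2/3::real} (\<lambda>_. 0)"
    by (intro integral_cong) (auto simp: g(2))
  then have 1: "G (2/3) = G (1/3)" using ftc[of "1/3" "2/3" 0] by simp
  have "integral {-2/3..-1/3} (\<lambda>t. g (t - 0)) = integral {-2/3..-1/3::real} (\<lambda>_. 0)"
    by (intro integral_cong) (auto simp: g(2))
  then have "G (-2/3) = G (-1/3)" using ftc[of "-2/3" "-1/3" 0] by simp
  then show ?thesis using 1 ftc[of 0 1 "1/3"] ftc[of 0 1 "2/3"] by simp
qed

section \<open>Choice of the profiles and of the rotation speeds\<close>

lemma DiffR_profile: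
  assumes "\<phi> \<in> carrier DiffR" shows "profile (\<lambda>x. \<phi> x - x)"
proof
  note \<phi> = DiffR_D[OF assms]
  have "D (\<lambda>x. \<phi> x - x) = (\<lambda>x. D \<phi> x - 1)"
    by (rule D_eqI) (intro has_vector_derivative_diff smooth_has_vector_derivative \<phi> has_vector_derivative_id)
  then show "0 < 1 + D (\<lambda>x. \<phi> x - x) x" for x using \<phi>(4) by simp
  show "smooth (\<lambda>x. \<phi> x - x)"
    unfolding smooth_iff_smooth2 by (intro smooth2_intros smooth2_of_smooth \<phi>)
  show "\<phi> (x + 2 * pi) - (x + 2 * pi) = \<phi> x - x" for x by (simp add: \<phi>(5))
qed

lemma horizontal_path_between:
  fixes E :: real
  assumes "\<phi>\<^sub>0 \<in> carrier DiffR" "\<phi>\<^sub>1 \<in> carrier DiffR"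
  obtains \<phi> where "smooth2 \<phi>" "\<And>t. \<phi> t \<in> carrier DiffR" "\<phi> 0 = \<phi>\<^sub>0" "\<phi> 1 = \<phi>\<^sub>1"
    "\<And>t. integral {0..2 * pi} (\<lambda>x. Dt \<phi> t x / Dx \<phi> t x) = 0"
    "integral {0..1} (\<lambda>t. integral {0..2 * pi}
       (\<lambda>x. Dx (\<lambda>t x. Dt \<phi> t x / Dx \<phi> t x) t x * Dx (Dx \<phi>) t x / Dx \<phi> t x)) = E"
proof -
  define h where "h i = (if i = 0 then (\<lambda>x. \<phi>\<^sub>0 x - x) else if i = 1 then wave1 else if i = 2 then wave2
    else (\<lambda>x. \<phi>\<^sub>1 x - x))" for i :: nat
  interpret profiles h
    by (rule profiles.intro) (auto simp: h_def DiffR_profile assms profile_wave)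
  have h12: "h 1 = wave1" "h (Suc 0) = wave1" "h 2 = wave2" by (auto simp: h_def)
  define K L C0 E0 where "K = integral {0..1} (kap 1)" and "L = integral {0..1} (lam 1)"
    and "C0 = (\<Sum>i<4. integral {0..1} (kap0 i))" and "E0 = (\<Sum>i<4. integral {0..1} (lam0 i))"
  define k l where "k t = 2 * pi / Iint wave1 (bump t) - 1"
    and "l t = - 2 * pi * Mint wave1 (bump t) / Iint wave1 (bump t)" for t
  have kl: "kap 1 = (\<lambda>t. k (t - 1/3))" "kap 2 = (\<lambda>t. k (t - 2/3))"
    "lam 1 = (\<lambda>t. l (t - 1/3))" "lam 2 = (\<lambda>t. 4 * l (t - 2/3))"
    by (auto simp: kap_def lam_def k_def l_def h12 \<rho>_def wave_scaling bump_nonneg bump_le_1)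
  note sm = profile.smooth_integrals[OF profile_wave(1) smooth_bump bump_nonneg bump_le_1, THEN smooth2_of_smooth(1)]
  have nz: "Iint wave1 (bump t) \<noteq> 0" for t
    using profile.Iint_pos[OF profile_wave(1) bump_nonneg bump_le_1, of t] by simp
  have "smooth k" "smooth l"
    unfolding smooth_iff_smooth2 k_def l_def by (intro smooth2_intros sm nz)+
  moreover have "k t = 0" "l t = 0" if "1 / 6 \<le> \<bar>t\<bar>" for t
    using that by (simp_all add: k_def l_def bump_eq_0 profile.integrals_0[OF profile_wave(1)])
  ultimately have K2: "integral {0..1} (kap 2) = K" and L2: "integral {0..1} (lam 2) = 4 * L"
    unfolding K_def L_def kl using integral_supported_shift by simp_all
  note cont = smooth_rates[THEN smooth_continuous, THEN continuous_on_subset, OF subset_UNIV]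
  have r1: "\<rho> 1 (1/3) = 1" by (simp add: \<rho>_def bump_0)
  \<comment> \<open>\<open>kap\<close> is nonpositive because \<open>Iint\<close> is at least
    \<open>2 * pi\<close>. It is strictly negative at the centre of the bump, as
    \<open>D wave1\<close> does not vanish at 0.\<close>
  have "0 < integral {0..1} (\<lambda>t. - kap 1 t)"
  proof (rule integral_continuous_pos[of _ _ _ "1/3"])
    show "0 \<le> - kap 1 t" for t
      using profile.Iint_ge[OF profile_h \<rho>_bounds, of 1 1 t] Iint_\<rho>_pos[of 1 t] by (simp add: kap_def)
    show "0 < - kap 1 (1/3)"
      using profile.Iint_gt[OF profile_wave(1), of 1 0] profile.Iint_pos[OF profile_wave(1), of 1] by (simp add: kap_def r1[simplified] h12 D_wave)
  qed (auto intro!: continuous_intros cont)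
  then have K: "K \<noteq> 0" by (auto simp: K_def)
  \<comment> \<open>The same argument for \<open>Mint\<close>; the second derivative of
    \<open>wave1\<close> is nonzero at \<open>pi / 2\<close>.\<close>
  have "0 < integral {0..1} (\<lambda>t. - lam 1 t)"
  proof (rule integral_continuous_pos[of _ _ _ "1/3"])
    show "0 \<le> - lam 1 t" for t
      using profile.Mint_nonneg[OF profile_h \<rho>_bounds, of 1 1 t] Iint_\<rho>_pos[of 1 t]
      by (simp add: lam_def)
    show "0 < - lam 1 (1/3)"
      using profile.Mint_pos[OF profile_wave(1), of 1 "pi / 2"] profile.Iint_pos[OF profile_wave(1), of 1]
      by (simp add: lam_def r1[simplified] h12 D_wave(2))
  qed (auto intro!: continuous_intros cont)
  then have L: "L \<noteq> 0" by (auto simp: L_def)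
  \<comment> \<open>\<open>S\<close> and \<open>T\<close> are the required values of
    \<open>w 1 + w 2\<close> and \<open>w 1 + 4 * w 2\<close>: no net translation, and total flux
    \<open>E\<close>.\<close>
  define S T where "S = - C0 / K" and "T = (E - E0) / L"
  \<comment> \<open>The solution of these two equations. Speed 0 for the outer profiles leaves the
    final profile unrotated at time 1.\<close>
  define w where "w i = (if i = 1 then S - (T - S) / 3 else if i = 2 then (T - S) / 3 else 0)" for i :: nat
  have sum4: "(\<Sum>i<4. f i) = f 0 + f 1 + f 2 + f 3" for f :: "nat \<Rightarrow> real"
    by (simp add: eval_nat_numeral)
  have "integral {0..1} (q w) = C0 + S * K"
    unfolding integral_rates C0_def sum4 by (simp add: w_def K2 flip: K_def) (simp add: field_simps K_def)
  then have q0: "integral {0..1} (q w) = 0" using K by (simp add: S_def)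
  have "integral {0..1} (\<beta> w) = E0 + T * L"
    unfolding integral_rates E0_def sum4 by (simp add: w_def L2 flip: L_def) (simp add: field_simps L_def)
  then have \<beta>E: "integral {0..1} (\<beta> w) = E" using L by (simp add: T_def)
  have \<rho>01: "\<rho> i 0 = (if i = 0 then 1 else 0)" "\<rho> i 1 = (if i = 3 then 1 else 0)" for i
  proof -
    have "1 / 6 \<le> \<bar>0 - real i / 3\<bar>" if "i \<noteq> 0" using that by (cases i) auto
    then show "\<rho> i 0 = (if i = 0 then 1 else 0)"
      using bump_eq_0[of "0 - real i / 3"] by (cases "i = 0") (auto simp: \<rho>_def bump_0)
    have "1 / 6 \<le> \<bar>1 - real i / 3\<bar>" if "i \<noteq> 3"
    proof -
      have "1 \<le> \<bar>real i - 3\<bar>" using that by linarith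
      then show ?thesis by argo
    qed
    then show "\<rho> i 1 = (if i = 3 then 1 else 0)"
      using bump_eq_0[of "1 - real i / 3"] by (cases "i = 3") (auto simp: \<rho>_def bump_0)
  qed
  obtain \<phi> where \<phi>: "smooth2 \<phi>" "\<And>t. \<phi> t \<in> carrier DiffR"
    "\<phi> 0 = (\<lambda>x. x + v w 0 x)" "\<phi> 1 = (\<lambda>x. x + integral {0..1} (q w) + v w 1 x)"
    "\<And>t. integral {0..2 * pi} (\<lambda>x. Dt \<phi> t x / Dx \<phi> t x) = 0"
    "\<And>t. integral {0..2 * pi} (\<lambda>x. Dx (\<lambda>t x. Dt \<phi> t x / Dx \<phi> t x) t x * Dx (Dx \<phi>) t x / Dx \<phi> t x) = \<beta> w t"
    by (rule horizontal_path[of w]) blast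
  show ?thesis
  proof (rule that[OF \<phi>(1,2)])
    show "\<phi> 0 = \<phi>\<^sub>0" "\<phi> 1 = \<phi>\<^sub>1"
      unfolding \<phi>(3,4) q0 v_def sum4 \<rho>01 by (auto simp: h_def w_def)
    show "integral {0..1} (\<lambda>t. integral {0..2 * pi}
       (\<lambda>x. Dx (\<lambda>t x. Dt \<phi> t x / Dx \<phi> t x) t x * Dx (Dx \<phi>) t x / Dx \<phi> t x)) = E"
      unfolding \<phi>(6) using \<beta>E by simp
  qed (rule \<phi>(5))
qed

section \<open>The Virasoro-Bott group\<close>

lemma DiffR_monoid [simp]: "mult DiffR = (\<circ>)" "one DiffR = id"
  by (simp_all add: DiffR_def)

text \<open>The left translate of the path to the identity at time \<open>t\<close>. The chain rule
  with the derivative of the inverse function gives the quotient, and this calculation serves all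
  three groups.\<close>

lemma left_translate:
  assumes \<phi>: "smooth2 \<phi>" "\<And>t. \<phi> t \<in> carrier DiffR"
  defines "G t s x \<equiv> inv_into UNIV (\<phi> t) (\<phi> s x)"
  shows "smooth2 (G t)" "G t t x = x" "Dt (G t) t x = Dt \<phi> t x / Dx \<phi> t x"
    "Dx (G t) s x > 0" "Dx (G t) t x = 1" "G t s (x + 2 * pi) = G t s x + 2 * pi"
proof -
  note d = DiffR_D[OF \<phi>(2)]
  show sm: "smooth2 (G t)"
    unfolding G_def[abs_def] by (intro smooth2_compose[OF d(3)] \<phi>)
  show "G t t x = x" for x by (simp add: G_def d(7))
  have Dx_eq: "Dx (G t) s x = D (inv_into UNIV (\<phi> t)) (\<phi> s x) * Dx \<phi> s x" for s x
  proof -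
    have "((\<lambda>x. G t s x) has_real_derivative D (inv_into UNIV (\<phi> t)) (\<phi> s x) * D (\<phi> s) x) (at x)"
      unfolding G_def by (intro DERIV_chain2[OF smooth_has_real_derivative[OF d(3)]] smooth_has_real_derivative d)
    then show ?thesis using smooth2_has_Dx[OF sm]
      unfolding has_real_derivative_iff_has_vector_derivative by (metis vector_derivative_at Dx_def)
  qed
  show "Dx (G t) s x > 0"
    unfolding Dx_eq using DiffR_D(4)[OF DiffR_inv_into[OF \<phi>(2)]] d(4) by (simp add: Dx_def)
  have inv: "D (inv_into UNIV (\<phi> t)) (\<phi> t x) = 1 / Dx \<phi> t x"
    using DiffR_inverse_has_derivative[OF \<phi>(2)] by (simp add: Dx_def)
  show "Dx (G t) t x = 1" unfolding Dx_eq inv using d(4)[of t x] by (simp add: Dx_def)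
  have "((\<lambda>s. G t s x) has_real_derivative D (inv_into UNIV (\<phi> t)) (\<phi> t x) * Dt \<phi> t x) (at t)"
    unfolding G_def using smooth2_has_Dt[OF \<phi>(1)]
    by (intro DERIV_chain2[OF smooth_has_real_derivative[OF d(3)]])
      (simp add: has_real_derivative_iff_has_vector_derivative)
  then show "Dt (G t) t x = Dt \<phi> t x / Dx \<phi> t x"
    using smooth2_has_Dt[OF sm, of x t] unfolding inv has_real_derivative_iff_has_vector_derivative
    by (simp add: vector_derivative_unique_at)
  show "G t s (x + 2 * pi) = G t s x + 2 * pi"
    by (simp add: G_def d(5) DiffR_inv_into_shift[OF \<phi>(2)])
qed

text \<open>The left logarithmic derivative of the path, in closed form.\<close>

definition velocity :: "(real \<Rightarrow> real \<Rightarrow> real) \<Rightarrow> real \<Rightarrow> real \<Rightarrow> real" where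
  "velocity \<phi> t x = Dt \<phi> t x / Dx \<phi> t x"

lemma Dx_pos: "\<phi> t \<in> carrier DiffR \<Longrightarrow> 0 < Dx \<phi> t x"
  by (simp add: Dx_def DiffR_D(4))

lemma smooth2_velocity:
  assumes "smooth2 \<phi>" "\<And>t. \<phi> t \<in> carrier DiffR" shows "smooth2 (velocity \<phi>)"
proof -
  have "Dx \<phi> t x \<noteq> 0" for t x using Dx_pos[of \<phi> t x] assms(2) by simp
  then show ?thesis unfolding velocity_def[abs_def]
    by (intro smooth2_intros smooth2_Dt smooth2_Dx assms(1))
qed

lemma velocity_Vect0:
  assumes \<phi>: "smooth2 \<phi>" "\<And>t. \<phi> t \<in> carrier DiffR"
    and "integral {0..2 * pi} (velocity \<phi> t) = 0"
  shows "velocity \<phi> t \<in> Vect0"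
proof -
  have K: "\<phi> t (x + 2 * pi) = \<phi> t x + 2 * pi" for t x by (rule DiffR_D(5)[OF \<phi>(2)])
  have "velocity \<phi> t (x + 2 * pi) = velocity \<phi> t x" for x
    unfolding velocity_def Dt_periodic[of \<phi> "2 * pi", OF \<phi>(1) K] Dx_periodic[of \<phi> t "2 * pi", OF \<phi>(1) K] ..
  then show ?thesis unfolding Vect0_def Vect_def
    using assms(3) smooth2_slice_x[OF smooth2_velocity[OF \<phi>], of t] by simp
qed

lemma DiffR_left_log_deriv:
  assumes \<phi>: "smooth2 \<phi>" "\<And>t. \<phi> t \<in> carrier DiffR"
  shows "has_Cinf_derivative (\<lambda>s. inv_into UNIV (\<phi> t) \<circ> \<phi> s) (velocity \<phi> t) t"
proof -
  note G = left_translate[OF \<phi>]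
  have "Dt (\<lambda>s x. inv_into UNIV (\<phi> t) (\<phi> s x)) t = velocity \<phi> t"
    by (auto simp: fun_eq_iff velocity_def G(3))
  with smooth2_has_Cinf_derivative[OF G(1), of t "2 * pi" t] G(6) show ?thesis
    by (simp add: o_def)
qed

lemma horizontal_R_path:
  assumes \<phi>: "smooth2 \<phi>" "\<And>t. \<phi> t \<in> carrier DiffR"
    and "\<And>t. integral {0..2 * pi} (velocity \<phi> t) = 0"
  shows "horizontal_R \<phi>"
  unfolding horizontal_R_def has_left_log_deriv_R_def DiffR_m_inv[OF \<phi>(2)] DiffR_monoid
  using smooth2_smooth_Cinf_curve[OF \<phi>(1) DiffR_D(5)[OF \<phi>(2)]] DiffR_left_log_deriv[OF \<phi>]
    velocity_Vect0[OF \<phi> assms(3)] \<phi>(2) by auto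

section \<open>Inverses in the extension and derivatives of the two cocycles\<close>

lemma VirG_mult: "(\<phi>1, b1) \<otimes>\<^bsub>VirG \<mu> \<nu>\<^esub> (\<phi>2, b2) =
    (\<phi>1 \<circ> \<phi>2, b1 + b2 + \<mu> * cocycleA \<phi>1 \<phi>2 + \<nu> * cocycleB \<phi>1 \<phi>2)"
  by (simp add: VirG_def)

lemma cocycleB_inverse: "\<phi>1 \<circ> \<phi>2 = id \<Longrightarrow> cocycleB \<phi>1 \<phi>2 = 0"
  by (simp add: cocycleB_def id_def)

text \<open>Only \<open>cocycleA\<close> survives in the fibre: \<open>cocycleB\<close> vanishes on
  a pair with composite \<open>id\<close>, since the logarithm of its derivative is 0. The first
  component already determines the inverse.\<close>

lemma VirG_m_inv:
  assumes "\<phi> \<in> carrier DiffR"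
  shows "inv\<^bsub>VirG \<mu> \<nu>\<^esub> (\<phi>, b) = (inv_into UNIV \<phi>, - b - \<mu> * cocycleA \<phi> (inv_into UNIV \<phi>))"
proof -
  note \<phi> = DiffR_D[OF assms]
  let ?\<psi> = "inv_into UNIV \<phi>"
  have inv: "\<phi> \<circ> ?\<psi> = id" "?\<psi> \<circ> \<phi> = id" by (simp_all add: fun_eq_iff \<phi>(6,7))
  have A: "cocycleA ?\<psi> \<phi> = cocycleA \<phi> ?\<psi>"
    unfolding cocycleA_def by (simp add: \<phi>(6,7) algebra_simps)
  have one: "\<one>\<^bsub>VirG \<mu> \<nu>\<^esub> = (id, 0)" by (simp add: VirG_def)
  show ?thesis
    unfolding m_inv_def one
  proof (rule the_equality)
    show "(?\<psi>, - b - \<mu> * cocycleA \<phi> ?\<psi>) \<in> carrier (VirG \<mu> \<nu>) \<and>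
      (\<phi>, b) \<otimes>\<^bsub>VirG \<mu> \<nu>\<^esub> (?\<psi>, - b - \<mu> * cocycleA \<phi> ?\<psi>) = (id, 0) \<and>
      (?\<psi>, - b - \<mu> * cocycleA \<phi> ?\<psi>) \<otimes>\<^bsub>VirG \<mu> \<nu>\<^esub> (\<phi>, b) = (id, 0)"
      unfolding VirG_mult by (simp add: inv A cocycleB_inverse) (simp add: VirG_def DiffR_inv_into[OF assms])
  next
    fix y assume y: "y \<in> carrier (VirG \<mu> \<nu>) \<and> (\<phi>, b) \<otimes>\<^bsub>VirG \<mu> \<nu>\<^esub> y = (id, 0) \<and> y \<otimes>\<^bsub>VirG \<mu> \<nu>\<^esub> (\<phi>, b) = (id, 0)"
    obtain \<eta> c where [simp]: "y = (\<eta>, c)" by (cases y)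
    have *: "\<phi> \<circ> \<eta> = id" "b + c + \<mu> * cocycleA \<phi> \<eta> + \<nu> * cocycleB \<phi> \<eta> = 0"
      using y by (simp_all add: VirG_mult)
    have "\<eta> x = ?\<psi> x" for x using \<phi>(7)[of "\<eta> x"] fun_cong[OF *(1), of x] by simp
    then have "\<eta> = ?\<psi>" by blast
    with * show "y = (?\<psi>, - b - \<mu> * cocycleA \<phi> ?\<psi>)" by (simp add: cocycleB_inverse)
  qed
qed

text \<open>Horizontality cancels the contribution of the left translate. What remains is the time
  derivative of an integral of \<open>\<phi> t\<close>, so its total depends only on the end
  points.\<close>

lemma cocycleA_has_derivative:
  assumes \<phi>: "smooth2 \<phi>" "\<And>t. \<phi> t \<in> carrier DiffR"
    and hor: "integral {0..2 * pi} (velocity \<phi> t) = 0"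
  shows "((\<lambda>s. cocycleA (inv_into UNIV (\<phi> t)) (\<phi> s)) has_real_derivative
    1 / (4 * pi) * integral {0..2 * pi} (Dt \<phi> t)) (at t)"
proof -
  note G = left_translate[OF \<phi>]
  let ?f = "inv_into UNIV (\<phi> t)" and ?G = "\<lambda>s x. inv_into UNIV (\<phi> t) (\<phi> s x)"
  let ?F = "\<lambda>s x. - ?G s x + ?f x + \<phi> s x - x"
  have F: "smooth2 ?F"
    by (intro smooth2_intros G \<phi> smooth2_of_smooth DiffR_D(3))
  have "Dt ?F = (\<lambda>s x. - Dt ?G s x + 0 + Dt \<phi> s x - 0)"
    by (rule Dt_eqI) (intro has_vector_derivative_diff has_vector_derivative_add
        has_vector_derivative_minus has_vector_derivative_const smooth2_has_Dt G \<phi>)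
  then have "Dt ?F t = (\<lambda>x. - velocity \<phi> t x + Dt \<phi> t x)"
    by (simp add: fun_eq_iff G(3) velocity_def)
  moreover have "integral {0..2 * pi} (\<lambda>x. - velocity \<phi> t x + Dt \<phi> t x) = integral {0..2 * pi} (Dt \<phi> t)"
  proof -
    have "velocity \<phi> t integrable_on {0..2 * pi}" "Dt \<phi> t integrable_on {0..2 * pi}"
      by (intro integrable_continuous_real smooth2_continuous_x smooth2_velocity[OF \<phi>] smooth2_Dt \<phi>)+
    from has_integral_add[OF has_integral_neg[OF integrable_integral[OF this(1)]] integrable_integral[OF this(2)]]
    show ?thesis using hor by (simp add: integral_unique)
  qed
  ultimately have "((\<lambda>s. integral {0..2 * pi} (?F s)) has_real_derivative integral {0..2 * pi} (Dt \<phi> t)) (at t)"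
    using smooth2_integral_has_derivative[OF F, of 0 "2 * pi" t]
    by (simp add: has_real_derivative_iff_has_vector_derivative)
  from DERIV_cmult[OF this] show ?thesis unfolding cocycleA_def .
qed

definition flux :: "(real \<Rightarrow> real \<Rightarrow> real) \<Rightarrow> real \<Rightarrow> real" where
  "flux \<phi> t = integral {0..2 * pi} (\<lambda>x. Dx (velocity \<phi>) t x * Dx (Dx \<phi>) t x / Dx \<phi> t x)"

text \<open>At \<open>s = t\<close> the left translate has space derivative 1, so the logarithm
  vanishes and the other factor need not be differentiated. Exchanging the partial derivatives turns
  the rest into the space derivative of \<open>velocity\<close>.\<close>

lemma cocycleB_has_derivative:
  assumes \<phi>: "smooth2 \<phi>" "\<And>t. \<phi> t \<in> carrier DiffR"
  shows "((\<lambda>s. cocycleB (inv_into UNIV (\<phi> t)) (\<phi> s)) has_real_derivative 1 / (4 * pi) * flux \<phi> t) (at t)"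
proof -
  note G = left_translate[OF \<phi>]
  define G where "G = (\<lambda>s x. inv_into UNIV (\<phi> t) (\<phi> s x))"
  have sG: "smooth2 G" and G_pos: "\<And>s x. 0 < Dx G s x" and G1: "\<And>x. Dx G t x = 1"
    and Gt: "\<And>x. Dt G t x = velocity \<phi> t x"
    unfolding G_def velocity_def by (rule G)+
  define Y where "Y = (\<lambda>s x. Dx (Dx \<phi>) s x / Dx \<phi> s x)"
  have pos: "0 < Dx \<phi> s x" for s x by (rule Dx_pos[OF \<phi>(2)])
  then have nz: "Dx \<phi> s x \<noteq> 0" for s x by (metis less_irrefl)
  have sY: "smooth2 Y" unfolding Y_def by (intro smooth2_intros smooth2_Dx \<phi> nz)
  define F where "F = (\<lambda>s x. ln (Dx G s x) * Y s x)"
  have sF: "smooth2 F" unfolding F_def by (intro smooth2_intros smooth2_Dx sG sY G_pos)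
  have "Dt F t x = Dx (velocity \<phi>) t x * Dx (Dx \<phi>) t x / Dx \<phi> t x" for x
  proof -
    have "((\<lambda>s. ln (Dx G s x)) has_real_derivative 1 / Dx G t x * Dt (Dx G) t x) (at t)"
      using smooth2_has_Dt[OF smooth2_Dx[OF sG]]
      by (intro DERIV_chain2[where g = "\<lambda>s. Dx G s x", OF DERIV_ln_divide[OF G_pos]])
        (simp add: has_real_derivative_iff_has_vector_derivative)
    moreover have "((\<lambda>s. Y s x) has_real_derivative Dt Y t x) (at t)"
      using smooth2_has_Dt[OF sY] by (simp add: has_real_derivative_iff_has_vector_derivative)
    ultimately have "((\<lambda>s. F s x) has_real_derivative
        (1 / Dx G t x * Dt (Dx G) t x) * Y t x + Dt Y t x * ln (Dx G t x)) (at t)"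
      unfolding F_def by (rule DERIV_mult)
    then have "((\<lambda>s. F s x) has_vector_derivative Dt (Dx G) t x * Y t x) (at t)"
      by (simp add: G1 has_real_derivative_iff_has_vector_derivative)
    moreover have "Dt (Dx G) t x = Dx (velocity \<phi>) t x"
    proof -
      have "Dt G t = velocity \<phi> t" using Gt by (rule ext)
      then show ?thesis unfolding Dt_Dx_commute[OF sG, symmetric] by (simp add: Dx_def)
    qed
    ultimately show ?thesis
      using smooth2_has_Dt[OF sF, of x t] by (simp add: Y_def vector_derivative_unique_at)
  qed
  then have 1: "integral {0..2 * pi} (Dt F t) = flux \<phi> t"
    unfolding flux_def by (intro integral_cong) simp
  have "ln (deriv (inv_into UNIV (\<phi> t) \<circ> \<phi> s) x) * deriv (\<lambda>\<tau>. ln (deriv (\<phi> s) \<tau>)) x = F s x" for s x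
  proof -
    have "deriv (inv_into UNIV (\<phi> t) \<circ> \<phi> s) = Dx G s"
      using smooth_deriv[OF smooth2_slice_x[OF sG], of s] by (simp add: Dx_def G_def o_def)
    moreover have "deriv (\<phi> s) = Dx \<phi> s"
      by (simp add: Dx_def smooth_deriv DiffR_D(2)[OF \<phi>(2)])
    moreover have "((\<lambda>\<tau>. ln (Dx \<phi> s \<tau>)) has_real_derivative 1 / Dx \<phi> s x * Dx (Dx \<phi>) s x) (at x)"
      using smooth2_has_Dx[OF smooth2_Dx[OF \<phi>(1)]]
      by (intro DERIV_chain2[where g = "Dx \<phi> s", OF DERIV_ln_divide[OF pos]])
        (simp add: has_real_derivative_iff_has_vector_derivative)
    ultimately show ?thesis by (simp add: F_def Y_def DERIV_imp_deriv)
  qed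
  then have "cocycleB (inv_into UNIV (\<phi> t)) (\<phi> s) = 1 / (4 * pi) * integral {0..2 * pi} (F s)" for s
    unfolding cocycleB_def by simp
  moreover have "((\<lambda>s. integral {0..2 * pi} (F s)) has_real_derivative flux \<phi> t) (at t)"
    using smooth2_integral_has_derivative[OF sF, of 0 "2 * pi" t] 1
    by (simp add: has_real_derivative_iff_has_vector_derivative)
  ultimately show ?thesis by (simp only: DERIV_cmult)
qed

lemma VirG_connected:
  assumes "\<nu> \<noteq> 0" "\<phi>\<^sub>0 \<in> carrier DiffR" "\<phi>\<^sub>1 \<in> carrier DiffR"
  obtains \<gamma> where "horizontal_VirG \<mu> \<nu> \<gamma>" "\<gamma> 0 = (\<phi>\<^sub>0, b\<^sub>0)" "\<gamma> 1 = (\<phi>\<^sub>1, b\<^sub>1)"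
proof -
  \<comment> \<open>The total flux for which the fibre coordinate \<open>b\<close> below ends at
    \<open>b\<^sub>1\<close>. Solving for it divides by \<open>\<nu>\<close>.\<close>
  define E where "E = (b\<^sub>0 - b\<^sub>1 - \<mu> / (4 * pi) * (integral {0..2 * pi} \<phi>\<^sub>1 - integral {0..2 * pi} \<phi>\<^sub>0)) * (4 * pi) / \<nu>"
  obtain \<phi> where \<phi>: "smooth2 \<phi>" "\<And>t. \<phi> t \<in> carrier DiffR" "\<phi> 0 = \<phi>\<^sub>0" "\<phi> 1 = \<phi>\<^sub>1"
    "\<And>t. integral {0..2 * pi} (velocity \<phi> t) = 0" "integral {0..1} (flux \<phi>) = E"
    using horizontal_path_between[OF assms(2,3), of E] unfolding flux_def[abs_def] velocity_def[abs_def] by blast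
  have nz: "Dx \<phi> t x \<noteq> 0" for t x using Dx_pos[of \<phi> t x] \<phi>(2) by simp
  have "smooth (flux \<phi>)"
    unfolding flux_def[abs_def]
    by (intro smooth_integral smooth2_intros smooth2_Dx smooth2_velocity[OF \<phi>(1,2)] \<phi> nz)
  then obtain w where w: "smooth w" "\<And>t. (w has_vector_derivative flux \<phi> t) (at t)" "w 0 = 0"
    using smooth_has_antiderivative[of "flux \<phi>" 0 0] by blast
  have w1: "w 1 = E"
    using fundamental_theorem_of_calculus[of 0 1 w "flux \<phi>"] has_vector_derivative_at_within[OF w(2)] w(3) \<phi>(6)
    by (simp add: integral_unique)
  \<comment> \<open>The fibre coordinate forced by horizontality: its derivative cancels those of
    both cocycle terms.\<close>
  define b where "b t = b\<^sub>0 - \<mu> / (4 * pi) * (integral {0..2 * pi} (\<phi> t) - integral {0..2 * pi} \<phi>\<^sub>0) - \<nu> / (4 * pi) * w t" for t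
  have "smooth b"
    unfolding smooth_iff_smooth2 b_def
    by (intro smooth2_intros smooth2_of_smooth smooth_integral \<phi> w)
  have b': "(b has_real_derivative - (\<mu> * (1 / (4 * pi) * integral {0..2 * pi} (Dt \<phi> t))) - \<nu> * (1 / (4 * pi) * flux \<phi> t)) (at t)" for t
  proof -
    have "(b has_real_derivative 0 - \<mu> / (4 * pi) * (integral {0..2 * pi} (Dt \<phi> t) - 0) - \<nu> / (4 * pi) * flux \<phi> t) (at t)"
      unfolding b_def using w(2) smooth2_integral_has_derivative[OF \<phi>(1)]
      by (intro DERIV_diff DERIV_cmult DERIV_const) (simp_all add: has_real_derivative_iff_has_vector_derivative)
    then show ?thesis by simp
  qed
  show ?thesis
  proof (rule that[of "\<lambda>t. (\<phi> t, b t)"])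
    show "(\<phi> 0, b 0) = (\<phi>\<^sub>0, b\<^sub>0)" by (simp add: \<phi> b_def w)
    show "(\<phi> 1, b 1) = (\<phi>\<^sub>1, b\<^sub>1)" using \<open>\<nu> \<noteq> 0\<close> by (simp add: \<phi> b_def w1 E_def)
    show "horizontal_VirG \<mu> \<nu> (\<lambda>t. (\<phi> t, b t))"
      unfolding horizontal_VirG_def
    proof (intro conjI ballI)
      show "(\<phi> t, b t) \<in> carrier (VirG \<mu> \<nu>)" for t by (simp add: VirG_def \<phi>)
      show "smooth_Cinf_curve (\<lambda>t. fst (\<phi> t, b t))"
        using smooth2_smooth_Cinf_curve[OF \<phi>(1) DiffR_D(5)[OF \<phi>(2)]] by simp
      show "smooth_real_curve (\<lambda>t. snd (\<phi> t, b t))"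
        using smooth_imp_smooth_real_curve[OF \<open>smooth b\<close>] by simp
      show "\<exists>v\<in>Vect0 \<times> {0}. has_left_log_deriv_VirG \<mu> \<nu> (\<lambda>t. (\<phi> t, b t)) v t" for t
      proof
        show "(velocity \<phi> t, 0) \<in> Vect0 \<times> {0}" by (simp add: velocity_Vect0 \<phi>)
        \<comment> \<open>Here \<open>k\<close> stands for the fibre component of the inverse of the
          point at time \<open>t\<close>, constant in \<open>s\<close>.\<close>
        have "((\<lambda>s. k + b s + \<mu> * cocycleA (inv_into UNIV (\<phi> t)) (\<phi> s) +
            \<nu> * cocycleB (inv_into UNIV (\<phi> t)) (\<phi> s)) has_real_derivative
            0 + (- (\<mu> * (1 / (4 * pi) * integral {0..2 * pi} (Dt \<phi> t))) - \<nu> * (1 / (4 * pi) * flux \<phi> t))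
            + \<mu> * (1 / (4 * pi) * integral {0..2 * pi} (Dt \<phi> t)) + \<nu> * (1 / (4 * pi) * flux \<phi> t)) (at t)" for k
          by (intro DERIV_add DERIV_const b' DERIV_cmult cocycleA_has_derivative cocycleB_has_derivative \<phi>)
        then have "((\<lambda>s. k + b s + \<mu> * cocycleA (inv_into UNIV (\<phi> t)) (\<phi> s) +
            \<nu> * cocycleB (inv_into UNIV (\<phi> t)) (\<phi> s)) has_real_derivative 0) (at t within {0..1})" for k
          by (simp add: has_field_derivative_at_within)
        then show "has_left_log_deriv_VirG \<mu> \<nu> (\<lambda>t. (\<phi> t, b t)) (velocity \<phi> t, 0) t"
          unfolding has_left_log_deriv_VirG_def VirG_m_inv[OF \<phi>(2)] VirG_mult
          using DiffR_left_log_deriv[OF \<phi>(1,2)] by simp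
      qed
    qed
  qed
qed

section \<open>Diffeomorphisms of the circle\<close>

lemma abs_circle_eq_iff: "abs_circle a = abs_circle b \<longleftrightarrow> (\<exists>k::int. a = b + 2 * pi * of_int k)"
  by (rule circle.abs_eq_iff)

lemma abs_circle_rep_circle: "abs_circle (rep_circle z) = z"
  by (rule Quotient3_abs_rep[OF Quotient3_circle])

lemma abs_circle_shift: "abs_circle (x + 2 * pi) = abs_circle x"
  unfolding abs_circle_eq_iff by (rule exI[of _ 1]) simp

lemma circle_emb_inject: "circle_emb z = circle_emb z' \<longleftrightarrow> z = z'"
proof
  assume "circle_emb z = circle_emb z'"
  then have "cis (rep_circle z) = cis (rep_circle z')"
    using circle_emb.abs_eq[of "rep_circle z"] circle_emb.abs_eq[of "rep_circle z'"]
    by (simp add: abs_circle_rep_circle)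
  then have "abs_circle (rep_circle z) = abs_circle (rep_circle z')"
    unfolding abs_circle_eq_iff using sin_cos_eq_iff[of "rep_circle z" "rep_circle z'"] by (simp add: complex_eq_iff)
  then show "z = z'" by (simp add: abs_circle_rep_circle)
qed simp

text \<open>The representative is arbitrary; if \<open>\<phi>\<close> commutes with the period, the
  value does not depend on it.\<close>

definition descend :: "(real \<Rightarrow> real) \<Rightarrow> circle \<Rightarrow> circle" where
  "descend \<phi> z = abs_circle (\<phi> (rep_circle z))"

lemma descend_abs_circle:
  assumes "\<And>x. \<phi> (x + 2 * pi) = \<phi> x + 2 * pi"
  shows "descend \<phi> (abs_circle x) = abs_circle (\<phi> x)"
proof -
  have "abs_circle (rep_circle (abs_circle x)) = abs_circle x" by (rule abs_circle_rep_circle)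
  then obtain k :: int where "rep_circle (abs_circle x) = x + 2 * pi * of_int k"
    unfolding abs_circle_eq_iff by blast
  then show ?thesis
    unfolding descend_def abs_circle_eq_iff using quasi_periodic_int[of \<phi> x k, OF assms] by auto
qed

lemma circle_map_descend:
  assumes "\<And>x. \<phi> (x + 2 * pi) = \<phi> x + 2 * pi"
  shows "circle_map (descend \<phi>) = (\<lambda>x. cis (\<phi> x))"
  by (simp add: circle_map_def descend_abs_circle[of \<phi>, OF assms] circle_emb.abs_eq)

lemma descend_comp:
  assumes "\<And>x. \<phi> (x + 2 * pi) = \<phi> x + 2 * pi"
  shows "descend \<phi> \<circ> descend \<psi> = descend (\<phi> \<circ> \<psi>)"
  by (simp add: fun_eq_iff descend_def[of \<psi>] descend_abs_circle[of \<phi>, OF assms] descend_def[of "\<phi> \<circ> \<psi>"])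

lemma descend_id: "descend id = id"
  by (simp add: fun_eq_iff descend_def abs_circle_rep_circle)

lemma cis_has_vector_derivative: "(cis has_vector_derivative \<i> * cis x) (at x)"
  using has_derivative_cis[OF has_derivative_ident] by (simp add: has_vector_derivative_def)

lemma smooth_cis: "smooth cis"
proof -
  have "((\<lambda>x. \<i> ^ k * cis x) has_vector_derivative \<i> ^ Suc k * cis x) (at x)" for k x
    using has_vector_derivative_mult_right[OF cis_has_vector_derivative, of "\<i> ^ k"] by (simp add: mult_ac)
  from smooth_sequenceI[of "\<lambda>k x. \<i> ^ k * cis x", OF this] show ?thesis by simp
qed

lemma DiffS1_monoid [simp]: "mult DiffS1 = (\<circ>)" "one DiffS1 = id"
  by (simp_all add: DiffS1_def)

lemma descend_inverse:
  assumes "\<phi> \<in> carrier DiffR"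
  shows "descend (inv_into UNIV \<phi>) \<circ> descend \<phi> = id" "descend \<phi> \<circ> descend (inv_into UNIV \<phi>) = id"
proof -
  note \<phi> = DiffR_D[OF assms] DiffR_inv_into_shift[OF assms]
  have "inv_into UNIV \<phi> \<circ> \<phi> = id" "\<phi> \<circ> inv_into UNIV \<phi> = id" by (simp_all add: fun_eq_iff \<phi>(6,7))
  then show "descend (inv_into UNIV \<phi>) \<circ> descend \<phi> = id" "descend \<phi> \<circ> descend (inv_into UNIV \<phi>) = id"
    by (simp_all add: descend_comp \<phi>(5,8) descend_id)
qed

lemma descend_DiffS1:
  assumes "\<phi> \<in> carrier DiffR" shows "descend \<phi> \<in> carrier DiffS1"
proof -
  note \<phi> = DiffR_D[OF assms] DiffR_inv_into_shift[OF assms]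
  have bij: "bij (descend \<phi>)"
    using descend_inverse[OF assms] by (rule o_bij)
  have "inv_into UNIV (descend \<phi>) = descend (inv_into UNIV \<phi>)"
    using descend_inverse[OF assms] by (intro inv_unique_comp)
  moreover have "smooth (\<lambda>x. cis (\<phi> x))" "smooth (\<lambda>x. cis (inv_into UNIV \<phi> x))"
    unfolding smooth_iff_smooth2 by (intro smooth2_compose[OF smooth_cis] smooth2_of_smooth \<phi>)+
  moreover have "D (\<lambda>x. cis (\<phi> x)) = (\<lambda>x. D \<phi> x *\<^sub>R (\<i> * cis (\<phi> x)))"
    by (rule D_eqI) (use vector_diff_chain_at[OF smooth_has_vector_derivative[OF \<phi>(2)] cis_has_vector_derivative] in \<open>simp add: o_def\<close>)
  ultimately show ?thesis
    using bij \<phi>(4) unfolding DiffS1_def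
    by (auto simp: circle_map_descend \<phi>(5,8))
qed

lemma DiffS1_m_inv_descend:
  assumes "\<phi> \<in> carrier DiffR"
  shows "inv\<^bsub>DiffS1\<^esub> (descend \<phi>) = descend (inv_into UNIV \<phi>)"
  unfolding m_inv_def DiffS1_monoid
proof (rule the_equality)
  show "descend (inv_into UNIV \<phi>) \<in> carrier DiffS1 \<and> descend \<phi> \<circ> descend (inv_into UNIV \<phi>) = id \<and>
      descend (inv_into UNIV \<phi>) \<circ> descend \<phi> = id"
    using descend_inverse[OF assms] descend_DiffS1[OF DiffR_inv_into[OF assms]] by blast
  show "y = descend (inv_into UNIV \<phi>)" if "y \<in> carrier DiffS1 \<and> descend \<phi> \<circ> y = id \<and> y \<circ> descend \<phi> = id" for y
  proof -
    have "y = (descend (inv_into UNIV \<phi>) \<circ> descend \<phi>) \<circ> y" by (simp add: descend_inverse[OF assms])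
    also have "\<dots> = descend (inv_into UNIV \<phi>) \<circ> (descend \<phi> \<circ> y)" by (rule comp_assoc)
    finally show ?thesis using that by simp
  qed
qed

lemma horizontal_S1_path:
  assumes \<phi>: "smooth2 \<phi>" "\<And>t. \<phi> t \<in> carrier DiffR"
    and hor: "\<And>t. integral {0..2 * pi} (velocity \<phi> t) = 0"
  shows "horizontal_S1 (\<lambda>t. descend (\<phi> t))"
  unfolding horizontal_S1_def
proof (intro conjI ballI)
  note d = DiffR_D[OF \<phi>(2)] DiffR_inv_into_shift[OF \<phi>(2)]
  note G = left_translate[OF \<phi>]
  have cis_shift: "cis (x + 2 * pi) = cis x" for x by (simp add: complex_eq_iff)
  fix t
  show "descend (\<phi> t) \<in> carrier DiffS1" by (rule descend_DiffS1[OF \<phi>(2)])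
  have "smooth_Cinf_curve (\<lambda>t x. cis (\<phi> t x))"
    by (rule smooth2_smooth_Cinf_curve[of _ 0]) (auto intro: smooth2_compose[OF smooth_cis] \<phi> simp: d(5) cis_shift)
  then show "smooth_Cinf_curve (\<lambda>t. circle_map (descend (\<phi> t)))"
    by (simp add: circle_map_descend d(5))
  show "\<exists>x\<in>Vect0. has_left_log_deriv_S1 (\<lambda>t. descend (\<phi> t)) x t"
  proof
    show "velocity \<phi> t \<in> Vect0" by (rule velocity_Vect0[OF \<phi> hor])
    let ?G = "\<lambda>s x. inv_into UNIV (\<phi> t) (\<phi> s x)"
    \<comment> \<open>The left translate on the circle is \<open>cis\<close> of the one on the line.
      At \<open>s = t\<close> the latter is the identity, so the tangent vector has the same
      coefficient \<open>velocity \<phi> t\<close>.\<close>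
    have "Dt (\<lambda>s x. cis (?G s x)) = (\<lambda>s x. Dt ?G s x *\<^sub>R (\<i> * cis (?G s x)))"
      by (rule Dt_eqI) (use vector_diff_chain_at[OF smooth2_has_Dt[OF G(1)] cis_has_vector_derivative] in \<open>simp add: o_def\<close>)
    then have "Dt (\<lambda>s x. cis (?G s x)) t = (\<lambda>x. velocity \<phi> t x *\<^sub>R (\<i> * cis x))"
      by (simp add: fun_eq_iff G(2,3) velocity_def)
    moreover have "has_Cinf_derivative (\<lambda>s x. cis (?G s x)) (Dt (\<lambda>s x. cis (?G s x)) t) t"
      by (rule smooth2_has_Cinf_derivative[of _ 0]) (auto intro: smooth2_compose[OF smooth_cis] G(1) simp: G(6) cis_shift)
    moreover have "circle_map (inv\<^bsub>DiffS1\<^esub> (descend (\<phi> t)) \<otimes>\<^bsub>DiffS1\<^esub> descend (\<phi> s)) = (\<lambda>x. cis (?G s x))" for s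
      by (simp add: DiffS1_m_inv_descend \<phi> descend_comp d circle_map_descend)
    ultimately show "has_left_log_deriv_S1 (\<lambda>t. descend (\<phi> t)) (velocity \<phi> t) t"
      unfolding has_left_log_deriv_S1_def by simp
  qed
qed

section \<open>Lifting circle diffeomorphisms to the line\<close>

lemma smooth_Re_Im:
  assumes "smooth f" shows "smooth (\<lambda>x. Re (f x))" "smooth (\<lambda>x. Im (f x))"
proof -
  have d: "((D ^^ k) f has_vector_derivative (D ^^ Suc k) f x) (at x)" for k x
    using assms unfolding smooth_def by (simp add: D_def vector_derivative_works)
  show "smooth (\<lambda>x. Re (f x))"
    using smooth_sequenceI[of "\<lambda>k x. Re ((D ^^ k) f x)"] bounded_linear.has_vector_derivative[OF bounded_linear_Re d] by simp
  show "smooth (\<lambda>x. Im (f x))"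
    using smooth_sequenceI[of "\<lambda>k x. Im ((D ^^ k) f x)"] bounded_linear.has_vector_derivative[OF bounded_linear_Im d] by simp
qed

text \<open>The lift is an antiderivative of the speed \<open>r\<close> in \<open>D (circle_map f) = r *\<^sub>R (\<i> * circle_map f)\<close>.
  It increases by \<open>2 * pi * k\<close> over a period, and \<open>k = 1\<close> because \<open>f\<close> is injective.\<close>

lemma DiffS1_lift:
  assumes f: "f \<in> carrier DiffS1"
  obtains \<phi> where "\<phi> \<in> carrier DiffR" "descend \<phi> = f"
proof -
  define F where "F = circle_map f"
  have bij: "bij f" and sF: "smooth F" and "\<forall>\<theta>. \<exists>r>0. D F \<theta> = r *\<^sub>R (\<i> * F \<theta>)"
    using f by (auto simp: DiffS1_def F_def)
  then obtain r where r: "\<And>x. 0 < r x" "\<And>x. D F x = r x *\<^sub>R (\<i> * F x)" by metis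
  have F_cis: "\<exists>a. F x = cis a" for x
    using circle_emb.abs_eq[of "rep_circle (f (abs_circle x))"]
    by (auto simp: F_def circle_map_def abs_circle_rep_circle)
  have Fper: "F (x + 2 * pi) = F x" for x by (simp add: F_def circle_map_def abs_circle_shift)
  \<comment> \<open>The speed \<open>r\<close> was chosen pointwise; expressing it through
    \<open>F\<close> and \<open>D F\<close> yields its smoothness and periodicity.\<close>
  have r_eq: "r x = Re (F x) * Im (D F x) - Im (F x) * Re (D F x)" for x
  proof -
    obtain a where "F x = cis a" using F_cis by blast
    then have "Re (F x) * Im (D F x) - Im (F x) * Re (D F x) = cos a * (r x * cos a) - sin a * (r x * - sin a)"
      by (simp add: r(2))
    also have "\<dots> = r x * ((cos a)\<^sup>2 + (sin a)\<^sup>2)"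
      by (simp only: power2_eq_square distrib_left mult_minus_right diff_minus_eq_add mult_ac)
    finally show ?thesis by simp
  qed
  have "smooth r"
    unfolding smooth_iff_smooth2 r_eq by (intro smooth2_intros smooth2_of_smooth smooth_Re_Im smooth_D sF)
  then obtain \<phi> where \<phi>: "smooth \<phi>" "\<And>x. (\<phi> has_vector_derivative r x) (at x)" "\<phi> 0 = rep_circle (f (abs_circle 0))"
    using smooth_has_antiderivative by metis
  have D\<phi>: "D \<phi> = r" by (rule D_eqI[OF \<phi>(2)])
  have F_eq: "F x = cis (\<phi> x)" for x
  proof -
    \<comment> \<open>The quotient of \<open>F\<close> and the candidate
      \<open>cis (\<phi> x)\<close> has derivative 0, hence is constant; its value at 0 is
      1.\<close>
    have "((\<lambda>x. F x * cis (- \<phi> x)) has_vector_derivative 0) (at x)" for x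
    proof -
      have "((\<lambda>x. - \<phi> x) has_vector_derivative - r x) (at x)"
        by (intro has_vector_derivative_minus \<phi>)
      from vector_diff_chain_at[OF this cis_has_vector_derivative]
      have "((\<lambda>x. cis (- \<phi> x)) has_vector_derivative - r x *\<^sub>R (\<i> * cis (- \<phi> x))) (at x)"
        by (simp add: o_def)
      from has_vector_derivative_mult[OF smooth_has_vector_derivative[OF sF, of x] this]
      show ?thesis by (simp add: r(2) mult_ac)
    qed
    then obtain c where c: "\<And>x. F x * cis (- \<phi> x) = c"
      using has_vector_derivative_zero_constant[of UNIV "\<lambda>x. F x * cis (- \<phi> x)"] by auto
    have "F 0 = cis (\<phi> 0)"
      using circle_emb.abs_eq[of "\<phi> 0"] by (simp add: F_def circle_map_def \<phi>(3) abs_circle_rep_circle)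
    then have "c = 1" using c[of 0] by (simp add: cis_mult)
    then have "F x * (cis (- \<phi> x) * cis (\<phi> x)) = cis (\<phi> x)" using c[of x] by (simp flip: mult.assoc)
    then show ?thesis by (simp add: cis_mult)
  qed
  have f_eq: "f (abs_circle x) = abs_circle (\<phi> x)" for x
  proof -
    have "circle_emb (f (abs_circle x)) = circle_emb (abs_circle (\<phi> x))"
      using F_eq[of x] by (simp add: F_def circle_map_def circle_emb.abs_eq)
    then show ?thesis by (simp add: circle_emb_inject)
  qed
  have D_pos: "0 < D \<phi> x" for x by (simp add: D\<phi> r)
  note less_iff = positive_derivative_less_iff[OF \<phi>(1) D_pos]
  have rper: "r (x + 2 * pi) = r x" for x
    using vector_derivative_shift[OF smooth_has_vector_derivative[OF sF], of "2 * pi" 0] Fper by (simp add: r_eq)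
  have "((\<lambda>x. \<phi> (x + 2 * pi) - \<phi> x) has_real_derivative r (x + 2 * pi) * 1 - r x) (at x)" for x
    using \<phi>(2)[folded has_real_derivative_iff_has_vector_derivative]
    by (intro DERIV_diff DERIV_chain2[of \<phi>]) (auto intro!: derivative_eq_intros)
  then have const: "\<phi> (x + 2 * pi) - \<phi> x = \<phi> (0 + 2 * pi) - \<phi> 0" for x
    using DERIV_isconst_all[of "\<lambda>x. \<phi> (x + 2 * pi) - \<phi> x" x 0] by (simp add: rper)
  have "abs_circle (\<phi> (2 * pi)) = abs_circle (\<phi> 0)"
    using f_eq[of "2 * pi"] f_eq[of 0] abs_circle_shift[of 0] by simp
  then obtain k :: int where k: "\<phi> (2 * pi) = \<phi> 0 + 2 * pi * of_int k" unfolding abs_circle_eq_iff by blast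
  have "\<phi> 0 < \<phi> (2 * pi)" by (simp add: less_iff)
  then have "0 < k" using k by (simp add: zero_less_mult_iff)
  moreover have "\<not> 1 < k"
  proof
    assume "1 < k"
    then have "2 * pi * 1 < 2 * pi * of_int k" by (intro mult_strict_left_mono) auto
    then have lt: "\<phi> 0 + 2 * pi < \<phi> (2 * pi)" using k by simp
    \<comment> \<open>If \<open>k\<close> exceeded 1, the lift would gain a full turn strictly
      inside the period, and \<open>f\<close> would take its value at 0 twice.\<close>
    have "\<exists>y\<ge>0. y \<le> 2 * pi \<and> \<phi> y = \<phi> 0 + 2 * pi"
      using lt by (intro IVT' continuous_on_subset[OF smooth_continuous[OF \<phi>(1)]]) auto
    then obtain y where y: "\<phi> y = \<phi> 0 + 2 * pi" by blast
    then have "0 < y" "y < 2 * pi" using lt less_iff[of 0 y] less_iff[of y "2 * pi"] by auto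
    have "f (abs_circle y) = f (abs_circle 0)" by (simp add: f_eq y abs_circle_shift)
    then have "abs_circle y = abs_circle 0" using bij by (simp add: bij_is_inj inj_eq)
    then obtain m :: int where "y = 2 * pi * of_int m" unfolding abs_circle_eq_iff by auto
    then have "0 < real_of_int m" "2 * pi * real_of_int m < 2 * pi * 1"
      using \<open>0 < y\<close> \<open>y < 2 * pi\<close> by (auto simp: zero_less_mult_iff)
    then have "0 < m" "real_of_int m < 1" by (auto simp: mult_less_cancel_left)
    then show False by linarith
  qed
  ultimately have "k = 1" by simp
  then have per: "\<phi> (x + 2 * pi) = \<phi> x + 2 * pi" for x using const[of x] k by simp
  show ?thesis
  proof (rule that)
    show "\<phi> \<in> carrier DiffR" by (rule DiffR_I[OF \<phi>(1) D_pos per])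
    show "descend \<phi> = f"
    proof
      show "descend \<phi> z = f z" for z
        using descend_abs_circle[of \<phi> "rep_circle z", OF per] f_eq[of "rep_circle z"]
        by (simp add: abs_circle_rep_circle)
    qed
  qed
qed

theorem theorem5:
  "(\<forall>f\<in>carrier DiffS1. \<forall>g\<in>carrier DiffS1.
      \<exists>\<gamma>. horizontal_S1 \<gamma> \<and> \<gamma> 0 = f \<and> \<gamma> 1 = g) \<and>
   (\<forall>\<phi>\<in>carrier DiffR. \<forall>\<psi>\<in>carrier DiffR.
      \<exists>\<gamma>. horizontal_R \<gamma> \<and> \<gamma> 0 = \<phi> \<and> \<gamma> 1 = \<psi>) \<and>
   (\<forall>\<mu> \<nu>. \<nu> \<noteq> 0 \<longrightarrow>
      (\<forall>p\<in>carrier (VirG \<mu> \<nu>). \<forall>q\<in>carrier (VirG \<mu> \<nu>).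
         \<exists>\<gamma>. horizontal_VirG \<mu> \<nu> \<gamma> \<and> \<gamma> 0 = p \<and> \<gamma> 1 = q))"
proof (intro conjI ballI allI impI)
  \<comment> \<open>On the circle and on the line the flux is unconstrained; its total is set to
    0.\<close>
  have path: "\<exists>\<phi>. smooth2 \<phi> \<and> (\<forall>t. \<phi> t \<in> carrier DiffR) \<and> \<phi> 0 = \<phi>\<^sub>0 \<and> \<phi> 1 = \<phi>\<^sub>1 \<and>
      (\<forall>t. integral {0..2 * pi} (velocity \<phi> t) = 0)"
    if "\<phi>\<^sub>0 \<in> carrier DiffR" "\<phi>\<^sub>1 \<in> carrier DiffR" for \<phi>\<^sub>0 \<phi>\<^sub>1
    using horizontal_path_between[OF that, of 0] unfolding velocity_def[abs_def] by metis
  show "\<exists>\<gamma>. horizontal_R \<gamma> \<and> \<gamma> 0 = \<phi> \<and> \<gamma> 1 = \<psi>" if "\<phi> \<in> carrier DiffR" "\<psi> \<in> carrier DiffR" for \<phi> \<psi>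
    using path[OF that] horizontal_R_path by blast
  show "\<exists>\<gamma>. horizontal_S1 \<gamma> \<and> \<gamma> 0 = f \<and> \<gamma> 1 = g" if fg: "f \<in> carrier DiffS1" "g \<in> carrier DiffS1" for f g
  proof -
    \<comment> \<open>Any lifts of the end points will do: a horizontal path between them descends
      to the circle.\<close>
    obtain \<phi>\<^sub>0 \<phi>\<^sub>1 where 01: "\<phi>\<^sub>0 \<in> carrier DiffR" "descend \<phi>\<^sub>0 = f" "\<phi>\<^sub>1 \<in> carrier DiffR" "descend \<phi>\<^sub>1 = g"
      using DiffS1_lift fg by metis
    obtain \<phi> where \<phi>: "smooth2 \<phi>" "\<And>t. \<phi> t \<in> carrier DiffR" "\<phi> 0 = \<phi>\<^sub>0" "\<phi> 1 = \<phi>\<^sub>1"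
      "\<And>t. integral {0..2 * pi} (velocity \<phi> t) = 0"
      using path[OF 01(1,3)] by blast
    show ?thesis
      using horizontal_S1_path[OF \<phi>(1,2,5)] by (intro exI[of _ "\<lambda>t. descend (\<phi> t)"]) (simp add: \<phi> 01)
  qed
  show "\<exists>\<gamma>. horizontal_VirG \<mu> \<nu> \<gamma> \<and> \<gamma> 0 = p \<and> \<gamma> 1 = q"
    if "\<nu> \<noteq> 0" "p \<in> carrier (VirG \<mu> \<nu>)" "q \<in> carrier (VirG \<mu> \<nu>)" for \<mu> \<nu> p q
  proof -
    have "fst p \<in> carrier DiffR" "fst q \<in> carrier DiffR" using that by (auto simp: VirG_def)
    from VirG_connected[OF that(1) this, of \<mu> "snd p" "snd q"] show ?thesis by (metis prod.collapse)
  qed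
qed

end
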